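(* Let $P$ be a transferable well partially ordered set. (1) For every $1\le m<\omega$, $\mathbf{w}(P)\cdot m\le\mathbf{w}(P\times m)\le\mathbf{w}(P)\otimes m$. (2) If $\mathbf{w}(P)=\omega^\gamma$ for some ordinal $\gamma$, then $\mathbf{w}(P\times m)=\mathbf{w}(P)\cdot m$ for every $1\le m<\omega$. (3) $\mathbf{w}(\omega\times\omega\times\omega)=\omega^2$.
   Context: A well partial order is a poset with no infinite strictly decreasing sequences and no infinite antichains. Products carry the componentwise order; ordinals (including finite $m$) are regarded as linear orders. $\mathbf{w}(P)$ is the rank of the tree of non-empty finite sequences of pairwise incomparable elements ordered by strict initial segment $\sqsubset$ (least ordinal $\gamma$ with some $f$ into $\gamma$ such that $s\sqsubset t\implies f(s)>f(t)$). $\otimes$ is the natural (Hessenberg) product of ordinals. For $x\in P$ let $\downarrow x=\{y\in P:y\le x\}$; a poset $P$ without infinite antichains is transferable if $\mathbf{w}(P\setminus(\downarrow x_1\cup\dots\cup\downarrow x_n))=\mathbf{w}(P)$ for all finitely many $x_1,\dots,x_n\in P$. *)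

theory Defs
  imports Main "HOL-Library.Sublist" "HOL-Library.Multiset"
begin

unbundle cardinal_syntax

text \<open>
  A poset is a relation \<open>r\<close> with \<open>Partial_order r\<close>; its underlying set is \<open>Field r\<close>.
  An ordinal is a relation with \<open>Well_order\<close>, taken up to \<open>=o\<close> and compared by \<open>\<le>o\<close>, which also
  relate well-orders on different types.  The ordinals \<open>m\<close> and \<open>\<omega>\<close> are \<open>natLeq_on m\<close> and \<open>natLeq\<close>.
\<close>

definition prod_rel :: "'a rel \<Rightarrow> 'b rel \<Rightarrow> ('a \<times> 'b) rel"  (infixr \<open>\<times>\<^sub>p\<close> 80) where
  "r \<times>\<^sub>p s = {((a, b), (a', b')). (a, a') \<in> r \<and> (b, b') \<in> s}"

definition incomparable :: "'a rel \<Rightarrow> 'a \<Rightarrow> 'a \<Rightarrow> bool" where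
  "incomparable r x y \<longleftrightarrow> (x, y) \<notin> r \<and> (y, x) \<notin> r"

definition antichain :: "'a rel \<Rightarrow> 'a set \<Rightarrow> bool" where
  "antichain r A \<longleftrightarrow> A \<subseteq> Field r \<and> (\<forall>x\<in>A. \<forall>y\<in>A. x \<noteq> y \<longrightarrow> incomparable r x y)"

definition no_infinite_antichains :: "'a rel \<Rightarrow> bool" where
  "no_infinite_antichains r \<longleftrightarrow> (\<nexists>A. antichain r A \<and> infinite A)"

definition no_infinite_descent :: "'a rel \<Rightarrow> bool" where
  "no_infinite_descent r \<longleftrightarrow> (\<nexists>f :: nat \<Rightarrow> 'a. \<forall>i. (f (Suc i), f i) \<in> r \<and> f (Suc i) \<noteq> f i)"

definition well_partial_order :: "'a rel \<Rightarrow> bool" where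
  "well_partial_order r \<longleftrightarrow> Partial_order r \<and> no_infinite_descent r \<and> no_infinite_antichains r"


subsection \<open>Width\<close>

definition antichain_seqs :: "'a rel \<Rightarrow> 'a list set" where
  "antichain_seqs r = {xs. xs \<noteq> [] \<and> set xs \<subseteq> Field r \<and>
     (\<forall>i<length xs. \<forall>j<length xs. i \<noteq> j \<longrightarrow> incomparable r (xs ! i) (xs ! j))}"

definition ranked_by :: "'a list set \<Rightarrow> 'b rel \<Rightarrow> bool" where
  "ranked_by T \<gamma> \<longleftrightarrow> (\<exists>f. f ` T \<subseteq> Field \<gamma> \<and>
     (\<forall>s\<in>T. \<forall>t\<in>T. strict_prefix s t \<longrightarrow> (f t, f s) \<in> \<gamma> \<and> f t \<noteq> f s))"

text \<open>
  The least \<open>\<gamma>\<close> ranking \<open>T\<close> is the image of \<open>T\<close> under its minimal rank function, so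
  it has a representative whose field is a subset of \<open>T\<close>: restricting to well-orders on
  the type \<open>'a list\<close> does not change the minimum over all ordinals.
\<close>

definition tree_rank :: "'a list set \<Rightarrow> 'a list rel" where
  "tree_rank T = (SOME \<gamma>. Well_order \<gamma> \<and> ranked_by T \<gamma> \<and>
     (\<forall>\<delta> :: 'a list rel. Well_order \<delta> \<longrightarrow> ranked_by T \<delta> \<longrightarrow> \<gamma> \<le>o \<delta>))"

definition width :: "'a rel \<Rightarrow> 'a list rel" where
  "width r = tree_rank (antichain_seqs r)"

definition transferable :: "'a rel \<Rightarrow> bool" where
  "transferable r \<longleftrightarrow> Partial_order r \<and> no_infinite_antichains r \<and>
     (\<forall>X. finite X \<longrightarrow> X \<subseteq> Field r \<longrightarrow>
        width (Restr r (Field r - (\<Union>x\<in>X. under r x))) =o width r)"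


subsection \<open>Ordinal arithmetic\<close>

text \<open>\<open>r \<cdot>\<^sub>o s\<close> is \<open>s\<close> many copies of \<open>r\<close>: the second coordinate is the more significant one.\<close>

definition ord_prod :: "'a rel \<Rightarrow> 'b rel \<Rightarrow> ('a \<times> 'b) rel"  (infixl \<open>\<cdot>\<^sub>o\<close> 70) where
  "r \<cdot>\<^sub>o s = {((a, b), (a', b')). a \<in> Field r \<and> a' \<in> Field r \<and> b \<in> Field s \<and> b' \<in> Field s \<and>
     ((b, b') \<in> s \<and> b \<noteq> b' \<or> b = b' \<and> (a, a') \<in> r)}"

text \<open>
  \<open>\<omega>\<close> to the power \<open>s\<close>: finitely supported functions from \<open>s\<close> to \<open>\<omega>\<close>, compared at the
  largest argument where they differ.
\<close>

definition fin_supp :: "'a rel \<Rightarrow> ('a \<Rightarrow> nat) set" where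
  "fin_supp s = {f. finite {x. f x \<noteq> 0} \<and> {x. f x \<noteq> 0} \<subseteq> Field s}"

definition omega_pow :: "'a rel \<Rightarrow> ('a \<Rightarrow> nat) rel" where
  "omega_pow s = {(f, g). f \<in> fin_supp s \<and> g \<in> fin_supp s \<and>
     (f = g \<or> (\<exists>x\<in>Field s. f x < g x \<and> (\<forall>y. (x, y) \<in> s \<and> y \<noteq> x \<longrightarrow> f y = g y)))}"

text \<open>The ordinal sum \<open>r\<^sub>0 + r\<^sub>1 + \<dots>\<close> of a finite list of well-orders, tagged by position.\<close>

definition ord_sum_list :: "'a rel list \<Rightarrow> (nat \<times> 'a) rel" where
  "ord_sum_list rs = {((i, x), (j, y)). i < length rs \<and> j < length rs \<and>
     x \<in> Field (rs ! i) \<and> y \<in> Field (rs ! j) \<and> (i < j \<or> i = j \<and> (x, y) \<in> rs ! i)}"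


subsection \<open>Natural operations\<close>

abbreviation descending :: "'a rel list \<Rightarrow> bool" where
  "descending es \<equiv> sorted_wrt (\<lambda>d e. e \<le>o d) es"

text \<open>
  The exponents of the Cantor normal form of \<open>r\<close>, unique up to \<open>=o\<close>.  They are at most \<open>r\<close>
  and hence have representatives on the same type.
\<close>

definition cnf :: "'a rel \<Rightarrow> 'a rel list" where
  "cnf r = (SOME es. (\<forall>e\<in>set es. Well_order e) \<and> descending es \<and>
     r =o ord_sum_list (map omega_pow es))"

definition sort_desc :: "'a rel list \<Rightarrow> 'a rel list" where
  "sort_desc es = (SOME ds. mset ds = mset es \<and> descending ds)"

text \<open>
  For \<open>r = \<omega>\<^bsup>e\<^sub>1\<^esup> + \<dots> + \<omega>\<^bsup>e\<^sub>k\<^esup>\<close> and \<open>s = \<omega>\<^bsup>f\<^sub>1\<^esup> + \<dots> + \<omega>\<^bsup>f\<^sub>l\<^esup>\<close> in Cantor normal form, the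
  natural sum is the sum of all \<open>\<omega>\<^bsup>e\<^sub>i\<^esup>\<close> and \<open>\<omega>\<^bsup>f\<^sub>j\<^esup>\<close> in descending order, and the natural
  product is the sum of all \<open>\<omega>\<close> to the power \<open>e\<^sub>i \<oplus>\<^sub>o f\<^sub>j\<close> in descending order.
  The images under \<open>Inl\<close> and \<open>Inr\<close> only bring the exponents to a common type.
\<close>

definition nat_sum :: "'a rel \<Rightarrow> 'b rel \<Rightarrow> (nat \<times> ('a + 'b \<Rightarrow> nat)) rel"  (infixl \<open>\<oplus>\<^sub>o\<close> 65) where
  "r \<oplus>\<^sub>o s = ord_sum_list (map omega_pow (sort_desc
     (map (\<lambda>e. dir_image e Inl) (cnf r) @ map (\<lambda>f. dir_image f Inr) (cnf s))))"

definition nat_prod ::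
    "'a rel \<Rightarrow> 'b rel \<Rightarrow> (nat \<times> (nat \<times> ('a + 'b \<Rightarrow> nat) \<Rightarrow> nat)) rel"  (infixl \<open>\<otimes>\<^sub>o\<close> 70) where
  "r \<otimes>\<^sub>o s = ord_sum_list (map omega_pow (sort_desc [e \<oplus>\<^sub>o f. e \<leftarrow> cnf r, f \<leftarrow> cnf s]))"

end

theory Submission
  imports Defs
begin

text \<open>
  All ordinal inequalities are witnessed by strictly monotone maps.  For the lower bound one plays
  the rows of \<open>P \<times> m\<close> from top to bottom, each row contributing a full copy of \<open>width P\<close> because
  \<open>P\<close> is transferable.  For the upper bound one adds up the ranks of the \<open>m\<close> rows with the natural
  sum.  This is computed inside \<open>\<omega>\<^sup>E\<close> for a well-order \<open>E\<close> exceeding all exponents in question: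
  its elements are the Cantor normal forms with exponents in \<open>E\<close>, and natural addition is pointwise
  addition of coefficients.  If \<open>width P\<close> is a power of \<open>\<omega>\<close>, its \<open>m\<close>-fold natural sum is the
  product with \<open>m\<close> and both bounds agree.  For \<open>\<omega> \<times> \<omega> \<times> \<omega>\<close> the first element of a sequence
  confines the others to finitely many planes of width \<open>\<omega>\<close>, so the same natural sum stays
  below \<open>\<omega>\<^sup>2\<close>.
\<close>

subsection \<open>Well-orders and strictly monotone maps\<close>

text \<open>A sequence in \<open>P \<times>\<^sub>p natLeq_on m\<close> may jump between rows, so
  the ranks of the rows must be combined by an operation that drops strictly whenever one argument
  drops. Ordinal addition fails this on the left (1 + omega equals omega), which is why the natural
  sum appears. The top-down order of the lower bound is dictated by transferability: it speaks of
  removing sets \<open>under P x\<close>, and these are what an element of a higher row forbids in a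
  lower one; an element of a lower row would forbid what lies above it.

  The formal obstacle is that \<open>tree_rank\<close>, \<open>cnf\<close> and
  \<open>sort_desc\<close> are choices, determined only up to \<open>=o\<close> or up to the order
  of ties, and that exponents live on many types. Lists of exponents are therefore compared through
  one well-order \<open>E\<close>, a successor cardinal beyond all well-orders on a type: there
  isomorphic exponents become equal elements, and a descending sum of powers of omega depends only
  on a multiset of elements.\<close>

lemma Well_order_wf: "Well_order r \<Longrightarrow> wf (r - Id)"
  by (simp add: well_order_on_def)

lemma Well_order_refl: "Well_order r \<Longrightarrow> a \<in> Field r \<Longrightarrow> (a, a) \<in> r"
  by (auto simp: well_order_on_def linear_order_on_def partial_order_on_def preorder_on_def refl_on_def)

lemma Well_order_trans: "Well_order r \<Longrightarrow> (a, b) \<in> r \<Longrightarrow> (b, c) \<in> r \<Longrightarrow> (a, c) \<in> r"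
  by (auto simp: well_order_on_def linear_order_on_def partial_order_on_def preorder_on_def
      elim: transE)

lemma Well_order_antisym: "Well_order r \<Longrightarrow> (a, b) \<in> r \<Longrightarrow> (b, a) \<in> r \<Longrightarrow> a = b"
  by (auto simp: well_order_on_def linear_order_on_def partial_order_on_def dest: antisymD)

lemma Well_order_cases:
  assumes "Well_order r" "a \<in> Field r" "b \<in> Field r"
  obtains "(a, b) \<in> r - Id" | "a = b" | "(b, a) \<in> r - Id"
  using assms by (auto simp: well_order_on_def linear_order_on_def total_on_def)

lemma Well_order_linear:
  assumes "Well_order r" "a \<in> Field r" "b \<in> Field r"
  shows "(a, b) \<in> r \<or> (b, a) \<in> r - Id"
  by (rule Well_order_cases[OF assms]) (use Well_order_refl[OF assms(1,2)] in auto)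

lemma Well_order_strict_trans:
  "Well_order r \<Longrightarrow> (a, b) \<in> r - Id \<Longrightarrow> (b, c) \<in> r - Id \<Longrightarrow> (a, c) \<in> r - Id"
  using Well_order_trans Well_order_antisym by fast

lemma Well_order_le_strict_trans:
  "Well_order r \<Longrightarrow> (a, b) \<in> r \<Longrightarrow> (b, c) \<in> r - Id \<Longrightarrow> (a, c) \<in> r - Id"
  using Well_order_trans Well_order_antisym by fast

lemma Well_order_strict_le_trans:
  "Well_order r \<Longrightarrow> (a, b) \<in> r - Id \<Longrightarrow> (b, c) \<in> r \<Longrightarrow> (a, c) \<in> r - Id"
  using Well_order_trans Well_order_antisym by fast

lemma Well_order_ex_least:
  assumes "Well_order r" "A \<subseteq> Field r" "A \<noteq> {}"
  shows "\<exists>m\<in>A. \<forall>a\<in>A. (m, a) \<in> r"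
proof -
  obtain m where m: "m \<in> A" "\<And>y. (y, m) \<in> r - Id \<Longrightarrow> y \<notin> A"
    using Well_order_wf[OF assms(1)] assms(3) by (metis ex_in_conv wfE_min)
  have "(m, a) \<in> r" if "a \<in> A" for a
  proof -
    have "m \<in> Field r" "a \<in> Field r" using m that assms by auto
    then show ?thesis
    proof (rule Well_order_cases[OF assms(1)])
      assume "m = a" then show ?thesis using Well_order_refl[OF assms(1)] \<open>a \<in> Field r\<close> by blast
    qed (use m(2) that in blast)+
  qed
  with m show ?thesis by blast
qed

lemma Well_orderI:
  assumes "wf (r - Id)" "Refl r" "trans r" "Total r"
  shows "Well_order r"
proof -
  have "antisym r"
    using assms(1) by (auto intro!: antisymI dest: wf_not_sym)
  then show ?thesis using assms
    by (auto simp: well_order_on_def linear_order_on_def partial_order_on_def preorder_on_def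
        FieldI1 FieldI2)
qed

text \<open>Otherwise \<open>s\<close> is isomorphic to a proper initial segment of
  \<open>r\<close>, and composing with \<open>f\<close> gives a strictly monotone self-map
  \<open>h\<close> of \<open>r\<close> that sends some point below itself. For the least such point
  \<open>m\<close>, the point \<open>h m\<close> is a smaller one.\<close>

lemma strict_mono_ordLeq:
  assumes r: "Well_order r" and s: "Well_order s"
    and f: "\<And>a. a \<in> Field r \<Longrightarrow> f a \<in> Field s"
    and mono: "\<And>a b. (a, b) \<in> r - Id \<Longrightarrow> (f a, f b) \<in> s - Id"
  shows "r \<le>o s"
proof (rule ccontr)
  assume "\<not> r \<le>o s"
  then have "s <o r" using r s by (simp add: not_ordLeq_iff_ordLess)
  then obtain a where a: "a \<in> Field r" "s =o Restr r (underS r a)"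
    using ordLess_iff_ordIso_Restr[OF r s] by blast
  then obtain g where g: "iso s (Restr r (underS r a)) g"
    unfolding ordIso_def by blast
  have wr: "Well_order (Restr r (underS r a))" using r Well_order_Restr by blast
  have gS: "(g x, g y) \<in> r \<and> g x \<in> underS r a" if "(x, y) \<in> s" for x y
  proof -
    have "x \<in> Field s" "y \<in> Field s" using that by (auto simp: FieldI1 FieldI2)
    then have "(g x, g y) \<in> Restr r (underS r a)"
      using g that unfolding iso_iff2 by blast
    then show ?thesis by blast
  qed
  have inj: "inj_on g (Field s)" using g s wr by (simp add: iso_iff2 bij_betw_def)
  define h where "h = g \<circ> f"
  have h_lt: "(h x, a) \<in> r - Id" if "x \<in> Field r" for x
    using gS[OF Well_order_refl[OF s f[OF that]]] by (auto simp: h_def underS_def)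
  have h_mono: "(h x, h y) \<in> r - Id" if "(x, y) \<in> r - Id" for x y
  proof -
    have fxy: "(f x, f y) \<in> s - Id" using mono[OF that] .
    then have "g (f x) \<noteq> g (f y)" using inj by (auto simp: inj_on_def FieldI1 FieldI2)
    then show ?thesis using gS fxy by (auto simp: h_def)
  qed
  define A where "A = {x \<in> Field r. (h x, x) \<in> r - Id}"
  have "a \<in> A" using a h_lt by (auto simp: A_def)
  then obtain m where m: "m \<in> A" "\<And>y. (y, m) \<in> r - Id \<Longrightarrow> y \<notin> A"
    using Well_order_wf[OF r] by (metis wfE_min)
  have "(h m, m) \<in> r - Id" using m by (simp add: A_def)
  moreover from this have "h m \<in> A" using h_mono by (auto simp: A_def FieldI1)
  ultimately show False using m by blast
qed

lemma strict_mono_onto_ordIso: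
  assumes r: "Well_order r" and s: "Well_order s"
    and f: "f ` Field r = Field s"
    and mono: "\<And>a b. (a, b) \<in> r - Id \<Longrightarrow> (f a, f b) \<in> s - Id"
  shows "r =o s"
proof -
  have "r \<le>o s" by (rule strict_mono_ordLeq[OF r s _ mono]) (use f in auto)
  moreover have "s \<le>o r"
  proof (rule strict_mono_ordLeq[OF s r, where f = "inv_into (Field r) f"])
    fix a b assume ab: "(a, b) \<in> s - Id"
    then have F: "a \<in> f ` Field r" "b \<in> f ` Field r" using f by (auto simp: FieldI1 FieldI2)
    let ?a = "inv_into (Field r) f a" and ?b = "inv_into (Field r) f b"
    have "?a \<in> Field r" "?b \<in> Field r" using F by (simp_all add: inv_into_into)
    then show "(?a, ?b) \<in> r - Id"
    proof (rule Well_order_cases[OF r])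
      assume "?a = ?b" then have "a = b" using F by (metis f_inv_into_f)
      then show ?thesis using ab by simp
    next
      assume "(?b, ?a) \<in> r - Id"
      from mono[OF this] have "(b, a) \<in> s - Id" using F by (simp add: f_inv_into_f)
      then show ?thesis using ab Well_order_antisym[OF s] by blast
    qed
  qed (simp add: f inv_into_into)
  ultimately show ?thesis by (simp add: ordIso_iff_ordLeq)
qed

lemma ordIso_bij_betw:
  assumes "r =o s"
  obtains f where "bij_betw f (Field r) (Field s)"
  using assms unfolding ordIso_def iso_def by blast

lemma ordLeq_strict_mono:
  assumes "r \<le>o s"
  obtains f where "\<And>a. a \<in> Field r \<Longrightarrow> f a \<in> Field s"
    "\<And>a b. (a, b) \<in> r - Id \<Longrightarrow> (f a, f b) \<in> s - Id"
proof -
  from assms obtain f where w: "Well_order r" "Well_order s" and f: "embed r s f"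
    unfolding ordLeq_def by blast
  have c: "compat r s f" using embed_compat f w by blast
  have i: "inj_on f (Field r)" using embed_inj_on f w by blast
  have F: "f ` Field r \<subseteq> Field s" using embed_Field f w by blast
  show ?thesis
  proof (rule that)
    show "(f a, f b) \<in> s - Id" if "(a, b) \<in> r - Id" for a b
      using that c i by (auto simp: compat_def inj_on_def FieldI1 FieldI2)
  qed (use F in auto)
qed

section \<open>Initial segments as the ordinals below a given one\<close>

abbreviation initseg :: "'a rel \<Rightarrow> 'a \<Rightarrow> 'a rel" where
  "initseg r a \<equiv> Restr r (underS r a)"

lemma Field_Restr_subset_eq: "Well_order r \<Longrightarrow> A \<subseteq> Field r \<Longrightarrow> Field (Restr r A) = A"
  using Well_order_refl[of r] unfolding Field_def by blast

lemma Field_initseg: "Well_order r \<Longrightarrow> Field (initseg r a) = underS r a"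
  by (rule Field_Restr_subset_eq) (auto simp: underS_def Field_def)

lemma Well_order_initseg: "Well_order r \<Longrightarrow> Well_order (initseg r a)"
  by (rule Well_order_Restr)

lemma underS_mono:
  "Well_order r \<Longrightarrow> (a, b) \<in> r \<Longrightarrow> underS r a \<subseteq> underS r b"
  unfolding underS_def by (blast dest: Well_order_trans Well_order_antisym)

text \<open>Transfers comparisons between exponents, which are well-orders, to the elements that
  represent them in a common well-order.\<close>

lemma initseg_ordLeq_iff:
  assumes "Well_order r" "a \<in> Field r" "b \<in> Field r"
  shows "initseg r a \<le>o initseg r b \<longleftrightarrow> (a, b) \<in> r"
proof
  assume ab: "(a, b) \<in> r"
  show "initseg r a \<le>o initseg r b"
  proof (rule strict_mono_ordLeq[OF Well_order_initseg[OF assms(1)] Well_order_initseg[OF assms(1)]])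
    show "x \<in> Field (initseg r b)" if "x \<in> Field (initseg r a)" for x
      using that underS_mono[OF assms(1) ab] unfolding Field_initseg[OF assms(1)] by blast
    show "(x, y) \<in> initseg r b - Id" if "(x, y) \<in> initseg r a - Id" for x y
      using that underS_mono[OF assms(1) ab] by blast
  qed
next
  assume le: "initseg r a \<le>o initseg r b"
  show "(a, b) \<in> r"
  proof (rule ccontr)
    assume "(a, b) \<notin> r"
    then have ba: "(b, a) \<in> r - Id"
      using Well_order_linear[OF assms] by blast
    then have b: "b \<in> underS r a" by (auto simp: underS_def)
    have sub: "underS r b \<subseteq> underS r a"
      using ba underS_mono[OF assms(1)] by blast
    have "underS (initseg r a) b = underS r b"
      using b sub unfolding underS_def by blast
    moreover have "Restr (initseg r a) (underS r b) = initseg r b" using sub by blast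
    ultimately have "initseg r b <o initseg r a"
      using underS_Restr_ordLess[OF Well_order_initseg[OF assms(1), of a], of b] b
        Field_initseg[OF assms(1), of a] by force
    then show False using le not_ordLess_ordLeq by blast
  qed
qed

subsection \<open>Powers of omega, sums and products of well-orders\<close>

lemma Field_omega_pow: "Field (omega_pow s) = fin_supp s"
  unfolding Field_def omega_pow_def by blast

lemma omega_pow_strict_iff:
  "(f, g) \<in> omega_pow s - Id \<longleftrightarrow> f \<in> fin_supp s \<and> g \<in> fin_supp s \<and>
     (\<exists>x\<in>Field s. f x < g x \<and> (\<forall>y. (x, y) \<in> s \<and> y \<noteq> x \<longrightarrow> f y = g y))"
  by (auto simp: omega_pow_def)

lemma fin_supp_outside: "f \<in> fin_supp s \<Longrightarrow> x \<notin> Field s \<Longrightarrow> f x = 0"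
  by (auto simp: fin_supp_def)

lemma Well_order_finite_max:
  assumes "Well_order r" "finite A" "A \<noteq> {}" "A \<subseteq> Field r"
  obtains m where "m \<in> A" "\<And>a. a \<in> A \<Longrightarrow> (a, m) \<in> r"
proof -
  have "\<exists>m\<in>A. \<forall>a\<in>A. (a, m) \<in> r"
    using assms(2-4)
  proof (induction rule: finite_ne_induct)
    case (singleton x)
    then show ?case using Well_order_refl[OF assms(1)] by simp
  next
    case (insert x F)
    then obtain m where m: "m \<in> F" "\<forall>a\<in>F. (a, m) \<in> r" by auto
    have "x \<in> Field r" "m \<in> Field r" using insert m by auto
    then consider "(x, m) \<in> r" | "(m, x) \<in> r"
      using Well_order_linear[OF assms(1), of x m] by blast
    then show ?case
    proof cases
      case 1 then show ?thesis using m by blast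
    next
      case 2
      then have "\<forall>a\<in>insert x F. (a, x) \<in> r"
        using m Well_order_trans[OF assms(1)] Well_order_refl[OF assms(1) \<open>x \<in> Field r\<close>] by blast
      then show ?thesis by blast
    qed
  qed
  then show ?thesis using that by blast
qed

text \<open>Finite supports make the set of arguments of disagreement finite, so it has a largest
  element, and that element decides.\<close>

lemma omega_pow_strict_total:
  assumes s: "Well_order s" and f: "f \<in> fin_supp s" and g: "g \<in> fin_supp s" and "f \<noteq> g"
  shows "(f, g) \<in> omega_pow s - Id \<or> (g, f) \<in> omega_pow s - Id"
proof -
  let ?D = "{x. f x \<noteq> g x}"
  have "?D \<subseteq> {x. f x \<noteq> 0} \<union> {x. g x \<noteq> 0}" by auto
  then have "finite ?D" "?D \<subseteq> Field s"
    using f g by (auto simp: fin_supp_def intro: finite_subset)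
  moreover have "?D \<noteq> {}" using \<open>f \<noteq> g\<close> by auto
  ultimately obtain m where m: "m \<in> ?D" "\<And>a. a \<in> ?D \<Longrightarrow> (a, m) \<in> s"
    using Well_order_finite_max[OF s] by metis
  then have "\<forall>y. (m, y) \<in> s \<and> y \<noteq> m \<longrightarrow> f y = g y"
    using Well_order_antisym[OF s] by blast
  moreover have "m \<in> Field s" using m \<open>?D \<subseteq> Field s\<close> by blast
  moreover have "f m < g m \<or> g m < f m" using m by auto
  ultimately show ?thesis using f g unfolding omega_pow_strict_iff by metis
qed

lemma omega_pow_strict_trans:
  assumes s: "Well_order s"
    and "(f, g) \<in> omega_pow s - Id" "(g, h) \<in> omega_pow s - Id"
  shows "(f, h) \<in> omega_pow s - Id"
proof -
  obtain x where x: "x \<in> Field s" "f x < g x" "\<And>y. (x, y) \<in> s \<Longrightarrow> y \<noteq> x \<Longrightarrow> f y = g y"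
    using assms(2) unfolding omega_pow_strict_iff by blast
  obtain z where z: "z \<in> Field s" "g z < h z" "\<And>y. (z, y) \<in> s \<Longrightarrow> y \<noteq> z \<Longrightarrow> g y = h y"
    using assms(3) unfolding omega_pow_strict_iff by blast
  have F: "f \<in> fin_supp s" "h \<in> fin_supp s" using assms(2,3) unfolding omega_pow_strict_iff by auto
  from x(1) z(1) show ?thesis
  proof (rule Well_order_cases[OF s])
    assume "x = z"
    then have "f x < h x \<and> (\<forall>y. (x, y) \<in> s \<and> y \<noteq> x \<longrightarrow> f y = h y)" using x z by fastforce
    then show ?thesis using F x(1) unfolding omega_pow_strict_iff by blast
  next
    assume xz: "(x, z) \<in> s - Id"
    have "f z < h z" using x(3)[of z] z(2) xz by auto
    moreover have "f y = h y" if "(z, y) \<in> s" "y \<noteq> z" for y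
    proof -
      have "(x, y) \<in> s - Id" using Well_order_strict_le_trans[OF s xz that(1)] .
      then show ?thesis using x(3)[of y] z(3)[OF that] by auto
    qed
    ultimately show ?thesis using F z(1) unfolding omega_pow_strict_iff by blast
  next
    assume zx: "(z, x) \<in> s - Id"
    have "f x < h x" using z(3)[of x] x(2) zx by auto
    moreover have "f y = h y" if "(x, y) \<in> s" "y \<noteq> x" for y
    proof -
      have "(z, y) \<in> s - Id" using Well_order_strict_le_trans[OF s zx that(1)] .
      then show ?thesis using z(3)[of y] x(3)[OF that] by auto
    qed
    ultimately show ?thesis using F x(1) unfolding omega_pow_strict_iff by blast
  qed
qed

text \<open>Finitely supported functions are multisets, and the order of \<open>omega_pow\<close> is
  contained in the multiset extension.\<close>

lemma wf_omega_pow: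
  assumes s: "Well_order s"
  shows "wf (omega_pow s - Id)"
proof (rule wf_subset[OF wf_inv_image[OF wf_mult[OF Well_order_wf[OF s]], of Abs_multiset]], rule subrelI)
  fix f g assume "(f, g) \<in> omega_pow s - Id"
  then obtain x where x: "x \<in> Field s" "f x < g x" "\<And>y. (x, y) \<in> s \<Longrightarrow> y \<noteq> x \<Longrightarrow> f y = g y"
    and supp: "f \<in> fin_supp s" "g \<in> fin_supp s"
    unfolding omega_pow_strict_iff by blast
  define F where "F = Abs_multiset f"
  define G where "G = Abs_multiset g"
  have cF: "count F = f" and cG: "count G = g"
    using supp by (simp_all add: F_def G_def fin_supp_def Abs_multiset_inverse)
  let ?I = "F \<inter># G"
  \<comment> \<open>Agreement above \<open>x\<close> puts everything that \<open>F\<close> has in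
    excess strictly below \<open>x\<close>, and \<open>x\<close> itself is in excess in
    \<open>G\<close>.\<close>
  have "(?I + (F - G), ?I + (G - F)) \<in> mult (s - Id)"
  proof (rule one_step_implies_mult)
    have "x \<in># G - F" using x(2) by (simp add: in_diff_count cF cG)
    then show "G - F \<noteq> {#}" by auto
    show "\<forall>k\<in>set_mset (F - G). \<exists>j\<in>set_mset (G - F). (k, j) \<in> s - Id"
    proof
      fix k assume "k \<in># F - G"
      then have k: "g k < f k" by (simp add: in_diff_count cF cG)
      then have "k \<in> Field s" using fin_supp_outside[OF supp(1), of k] by force
      from this x(1) have "(k, x) \<in> s - Id"
        by (rule Well_order_cases[OF s]) (use k x(2) x(3)[of k] in auto)
      then show "\<exists>j\<in>set_mset (G - F). (k, j) \<in> s - Id" using \<open>x \<in># G - F\<close> by blast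
    qed
  qed
  moreover have "?I + (F - G) = F" "?I + (G - F) = G"
    by (auto intro!: multiset_eqI)
  ultimately show "(f, g) \<in> inv_image (mult (s - Id)) Abs_multiset"
    by (simp add: F_def G_def)
qed

lemma Well_order_omega_pow:
  assumes "Well_order s"
  shows "Well_order (omega_pow s)"
proof (rule Well_orderI)
  show "Refl (omega_pow s)"
    by (auto simp: refl_on_def Field_omega_pow) (auto simp: omega_pow_def)
  show "trans (omega_pow s)"
    using omega_pow_strict_trans[OF assms] by (intro transI) blast
  show "Total (omega_pow s)"
    using omega_pow_strict_total[OF assms] unfolding total_on_def Field_omega_pow by blast
qed (rule wf_omega_pow[OF assms])

text \<open>Coefficients are carried along a strictly monotone map of the exponents and are zero off
  its range; the argument that decides a comparison is carried along with them.\<close>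

lemma omega_pow_mono:
  assumes "r \<le>o s"
  shows "omega_pow r \<le>o omega_pow s"
proof -
  have r: "Well_order r" and s: "Well_order s" using assms ordLeq_Well_order_simp by auto
  obtain h where h: "\<And>a. a \<in> Field r \<Longrightarrow> h a \<in> Field s"
    "\<And>a b. (a, b) \<in> r - Id \<Longrightarrow> (h a, h b) \<in> s - Id"
    using ordLeq_strict_mono[OF assms] by metis
  have inj: "inj_on h (Field r)"
  proof (rule inj_onI)
    fix x y assume xy: "x \<in> Field r" "y \<in> Field r" "h x = h y"
    show "x = y"
      by (rule Well_order_cases[OF r xy(1,2)]) (use h(2) xy(3) in force)+
  qed
  define \<Phi> where "\<Phi> f y = (if y \<in> h ` Field r then f (inv_into (Field r) h y) else 0)"
    for f :: "'a \<Rightarrow> nat" and y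
  have \<Phi>h: "\<Phi> f (h x) = f x" if "x \<in> Field r" for f x
    using that inj by (simp add: \<Phi>_def)
  have supp: "\<Phi> f \<in> fin_supp s" if f: "f \<in> fin_supp r" for f
  proof -
    have "{y. \<Phi> f y \<noteq> 0} \<subseteq> h ` {x. f x \<noteq> 0}"
      using inj by (auto simp: \<Phi>_def split: if_splits)
    moreover have "{y. \<Phi> f y \<noteq> 0} \<subseteq> Field s" using h(1) by (auto simp: \<Phi>_def)
    ultimately show ?thesis using f by (auto simp: fin_supp_def intro: finite_subset)
  qed
  show ?thesis
  proof (rule strict_mono_ordLeq[OF Well_order_omega_pow[OF r] Well_order_omega_pow[OF s]])
    fix f g assume "(f, g) \<in> omega_pow r - Id"
    then obtain x where x: "x \<in> Field r" "f x < g x" "\<And>y. (x, y) \<in> r \<Longrightarrow> y \<noteq> x \<Longrightarrow> f y = g y"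
      and F: "f \<in> fin_supp r" "g \<in> fin_supp r"
      unfolding omega_pow_strict_iff by blast
    have "\<Phi> f y = \<Phi> g y" if y: "(h x, y) \<in> s" "y \<noteq> h x" for y
    proof (cases "y \<in> h ` Field r")
      case True
      then obtain z where z: "z \<in> Field r" "y = h z" by blast
      from x(1) z(1) have "(x, z) \<in> r - Id"
      proof (rule Well_order_cases[OF r])
        assume "(z, x) \<in> r - Id"
        from h(2)[OF this] show ?thesis using y z Well_order_antisym[OF s] by blast
      qed (use y z in auto)
      then show ?thesis using z x(3)[of z] by (auto simp: \<Phi>h)
    qed (simp add: \<Phi>_def)
    moreover have "\<Phi> f (h x) < \<Phi> g (h x)" using x by (simp add: \<Phi>h)
    ultimately show "(\<Phi> f, \<Phi> g) \<in> omega_pow s - Id"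
      using F h(1)[OF x(1)] supp unfolding omega_pow_strict_iff by blast
  qed (simp add: Field_omega_pow supp)
qed

lemma omega_pow_cong: "r =o s \<Longrightarrow> omega_pow r =o omega_pow s"
  by (simp add: omega_pow_mono ordIso_iff_ordLeq)

section \<open>Finite ordinal sums\<close>

lemma Field_ord_sum_list:
  assumes "\<forall>r\<in>set rs. Well_order r"
  shows "Field (ord_sum_list rs) = {(i, x). i < length rs \<and> x \<in> Field (rs ! i)}"
proof -
  have "(i, x) \<in> Field (ord_sum_list rs)" if "i < length rs" "x \<in> Field (rs ! i)" for i x
    using that Well_order_refl[of "rs ! i"] assms by (intro FieldI1[of _ "(i, x)"]) (auto simp: ord_sum_list_def)
  moreover have "i < length rs \<and> x \<in> Field (rs ! i)" if ix: "(i, x) \<in> Field (ord_sum_list rs)" for i x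
  proof -
    obtain q where "((i, x), q) \<in> ord_sum_list rs \<or> (q, (i, x)) \<in> ord_sum_list rs"
      using ix unfolding Field_def by blast
    then show ?thesis by (cases q) (auto simp: ord_sum_list_def)
  qed
  ultimately show ?thesis by blast
qed

lemma ord_sum_list_strict_iff:
  "((i, x), (j, y)) \<in> ord_sum_list rs - Id \<longleftrightarrow> i < length rs \<and> j < length rs \<and>
     x \<in> Field (rs ! i) \<and> y \<in> Field (rs ! j) \<and> (i < j \<or> i = j \<and> (x, y) \<in> rs ! i - Id)"
  by (auto simp: ord_sum_list_def)

lemma Well_order_ord_sum_list:
  assumes rs: "\<forall>r\<in>set rs. Well_order r"
  shows "Well_order (ord_sum_list rs)"
proof (rule Well_orderI)
  have w: "Well_order (rs ! i)" if "i < length rs" for i using rs that by simp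
  show "wf (ord_sum_list rs - Id)"
  proof (rule wfI_min)
    fix q :: "nat \<times> 'a" and Q assume "q \<in> Q"
    \<comment> \<open>A minimal element is found in the earliest summand that meets
      \<open>Q\<close>.\<close>
    define i where "i = (LEAST i. \<exists>x. (i, x) \<in> Q)"
    have "\<exists>x. (fst q, x) \<in> Q" using \<open>q \<in> Q\<close> by (metis prod.collapse)
    then have ex: "\<exists>x. (i, x) \<in> Q" unfolding i_def by (rule LeastI[where P = "\<lambda>i. \<exists>x. (i, x) \<in> Q"])
    have least: "i \<le> j" if "(j, x) \<in> Q" for j x 
      unfolding i_def by (rule Least_le[where P = "\<lambda>i. \<exists>x. (i, x) \<in> Q"]) (use that in blast)
    show "\<exists>z\<in>Q. \<forall>y. (y, z) \<in> ord_sum_list rs - Id \<longrightarrow> y \<notin> Q"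
    proof (cases "i < length rs")
      case True
      obtain x where x: "(i, x) \<in> Q" "\<And>y. (y, x) \<in> rs ! i - Id \<Longrightarrow> (i, y) \<notin> Q"
      proof -
        obtain x0 where x0: "x0 \<in> {x. (i, x) \<in> Q}" using ex by blast
        show thesis
          by (rule wfE_min[OF Well_order_wf[OF w[OF True]] x0]) (rule that, auto)
      qed
      have "p \<notin> Q" if p: "(p, (i, x)) \<in> ord_sum_list rs - Id" for p
      proof (cases p)
        case (Pair j y)
        have "j < i \<or> j = i \<and> (y, x) \<in> rs ! i - Id"
          using p unfolding Pair ord_sum_list_strict_iff by (elim conjE) auto
        then show ?thesis using x(2)[of y] least[of j y] Pair by auto
      qed
      then show ?thesis using x(1) by blast
    next
      case False
      obtain x where "(i, x) \<in> Q" using ex by blast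
      moreover have "(p, (i, x)) \<notin> ord_sum_list rs - Id" for p
        using False by (cases p) (simp add: ord_sum_list_def)
      ultimately show ?thesis by blast
    qed
  qed
  show "Refl (ord_sum_list rs)"
  proof (rule refl_onI)
    fix p assume "p \<in> Field (ord_sum_list rs)"
    then show "(p, p) \<in> ord_sum_list rs"
      using Well_order_refl[OF w] unfolding Field_ord_sum_list[OF rs]
      by (auto simp: ord_sum_list_def)
  qed
  show "trans (ord_sum_list rs)"
  proof (rule transI)
    fix p q u assume A: "(p, q) \<in> ord_sum_list rs" "(q, u) \<in> ord_sum_list rs"
    obtain i x j y k z where pqu: "p = (i, x)" "q = (j, y)" "u = (k, z)"
      by (cases p, cases q, cases u)
    have "i < length rs" using A(1) by (auto simp: pqu ord_sum_list_def)
    from Well_order_trans[OF w[OF this], of x y z] A show "(p, u) \<in> ord_sum_list rs"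
      by (auto simp: pqu ord_sum_list_def)
  qed
  show "Total (ord_sum_list rs)"
    unfolding total_on_def
  proof (intro ballI impI)
    fix p q assume F: "p \<in> Field (ord_sum_list rs)" "q \<in> Field (ord_sum_list rs)" and ne: "p \<noteq> q"
    obtain i x j y where pq: "p = (i, x)" "q = (j, y)" by (cases p, cases q)
    from F have F': "i < length rs" "j < length rs" "x \<in> Field (rs ! i)" "y \<in> Field (rs ! j)"
      unfolding pq Field_ord_sum_list[OF rs] by auto
    consider "i < j" | "j < i" | "i = j" "(x, y) \<in> rs ! i" | "i = j" "(y, x) \<in> rs ! i"
      using Well_order_linear[OF w[OF F'(1)] F'(3), of y] F' by (cases i j rule: linorder_cases) auto
    then show "(p, q) \<in> ord_sum_list rs \<or> (q, p) \<in> ord_sum_list rs"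
      by cases (use F' in \<open>simp_all add: pq ord_sum_list_def\<close>)
  qed
qed

lemma ord_sum_list_mono:
  assumes "list_all2 (\<lambda>r s. r \<le>o s) rs ss"
  shows "ord_sum_list rs \<le>o ord_sum_list ss"
proof -
  have len: "length rs = length ss" and le: "\<And>i. i < length rs \<Longrightarrow> rs ! i \<le>o ss ! i"
    using assms by (auto simp: list_all2_conv_all_nth)
  have wr: "\<forall>r\<in>set rs. Well_order r" and ws: "\<forall>s\<in>set ss. Well_order s"
    using le len ordLeq_Well_order_simp by (metis in_set_conv_nth)+
  have "\<exists>f. (\<forall>a\<in>Field (rs ! i). f a \<in> Field (ss ! i)) \<and>
      (\<forall>a b. (a, b) \<in> rs ! i - Id \<longrightarrow> (f a, f b) \<in> ss ! i - Id)" if "i < length rs" for i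
    by (rule ordLeq_strict_mono[OF le[OF that]]) blast
  then obtain f where f: "\<And>i a. i < length rs \<Longrightarrow> a \<in> Field (rs ! i) \<Longrightarrow> f i a \<in> Field (ss ! i)"
    "\<And>i a b. i < length rs \<Longrightarrow> (a, b) \<in> rs ! i - Id \<Longrightarrow> (f i a, f i b) \<in> ss ! i - Id"
    by metis
  show ?thesis
  proof (rule strict_mono_ordLeq[OF Well_order_ord_sum_list[OF wr] Well_order_ord_sum_list[OF ws],
        where f = "\<lambda>(i, a). (i, f i a)"])
    fix p q assume pq: "(p, q) \<in> ord_sum_list rs - Id"
    obtain i x j y where [simp]: "p = (i, x)" "q = (j, y)" by (cases p, cases q)
    show "((\<lambda>(i, a). (i, f i a)) p, (\<lambda>(i, a). (i, f i a)) q) \<in> ord_sum_list ss - Id"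
      using pq len f(1)[of i x] f(1)[of j y] f(2)[of i x y] by (auto simp: ord_sum_list_def)
  qed (auto simp: Field_ord_sum_list wr ws len f)
qed

lemma ord_sum_list_cong:
  assumes "list_all2 (\<lambda>r s. r =o s) rs ss"
  shows "ord_sum_list rs =o ord_sum_list ss"
proof -
  have "list_all2 (\<lambda>r s. r \<le>o s) rs ss" "list_all2 (\<lambda>r s. r \<le>o s) ss rs"
    using assms by (auto simp: list_all2_conv_all_nth ordIso_iff_ordLeq)
  then show ?thesis by (simp add: ord_sum_list_mono ordIso_iff_ordLeq)
qed

section \<open>Ordinal products\<close>

lemma Field_ord_prod:
  assumes "Well_order r" "Well_order s"
  shows "Field (r \<cdot>\<^sub>o s) = Field r \<times> Field s"
proof -
  have "(a, b) \<in> Field (r \<cdot>\<^sub>o s)" if "a \<in> Field r" "b \<in> Field s" for a b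
    using that Well_order_refl[OF assms(1)] by (intro FieldI1[of _ "(a, b)"]) (auto simp: ord_prod_def)
  moreover have "a \<in> Field r \<and> b \<in> Field s" if ab: "(a, b) \<in> Field (r \<cdot>\<^sub>o s)" for a b
  proof -
    obtain q where "((a, b), q) \<in> r \<cdot>\<^sub>o s \<or> (q, (a, b)) \<in> r \<cdot>\<^sub>o s"
      using ab unfolding Field_def by blast
    then show ?thesis by (cases q) (auto simp: ord_prod_def)
  qed
  ultimately show ?thesis by auto
qed

lemma ord_prod_strict_iff:
  "((a, b), (a', b')) \<in> r \<cdot>\<^sub>o s - Id \<longleftrightarrow> a \<in> Field r \<and> a' \<in> Field r \<and> b \<in> Field s \<and> b' \<in> Field s \<and>
     ((b, b') \<in> s - Id \<or> b = b' \<and> (a, a') \<in> r - Id)"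
  by (auto simp: ord_prod_def)

lemma Well_order_ord_prod:
  assumes r: "Well_order r" and s: "Well_order s"
  shows "Well_order (r \<cdot>\<^sub>o s)"
proof (rule Well_orderI)
  have "r \<cdot>\<^sub>o s - Id \<subseteq> inv_image ((s - Id) <*lex*> (r - Id)) prod.swap"
    by (auto simp: ord_prod_def)
  then show "wf (r \<cdot>\<^sub>o s - Id)"
    by (rule wf_subset[rotated]) (simp add: Well_order_wf r s wf_lex_prod wf_inv_image)
  show "Refl (r \<cdot>\<^sub>o s)"
  proof (rule refl_onI)
    fix p assume "p \<in> Field (r \<cdot>\<^sub>o s)"
    then show "(p, p) \<in> r \<cdot>\<^sub>o s"
      using Well_order_refl[OF r] unfolding Field_ord_prod[OF r s]
      by (auto simp: ord_prod_def)
  qed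
  have "(p, q) \<in> r \<cdot>\<^sub>o s - Id \<Longrightarrow> (q, u) \<in> r \<cdot>\<^sub>o s - Id \<Longrightarrow> (p, u) \<in> r \<cdot>\<^sub>o s - Id" for p q u
    using Well_order_strict_trans[OF r] Well_order_strict_trans[OF s]
    by (cases p, cases q, cases u) (simp only: ord_prod_strict_iff, blast)
  then show "trans (r \<cdot>\<^sub>o s)"
    by (intro transI) blast
  show "Total (r \<cdot>\<^sub>o s)"
    unfolding total_on_def Field_ord_prod[OF r s]
  proof (intro ballI impI)
    fix p q assume pq: "p \<in> Field r \<times> Field s" "q \<in> Field r \<times> Field s" "p \<noteq> q"
    then have F: "fst p \<in> Field r" "fst q \<in> Field r" "snd p \<in> Field s" "snd q \<in> Field s"
      by auto
    consider "(snd p, snd q) \<in> s - Id" | "(snd q, snd p) \<in> s - Id"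
      | "snd p = snd q" "(fst p, fst q) \<in> r" | "snd p = snd q" "(fst q, fst p) \<in> r"
      using Well_order_linear[OF s F(3,4)] Well_order_linear[OF r F(1,2)] by auto
    then show "(p, q) \<in> r \<cdot>\<^sub>o s \<or> (q, p) \<in> r \<cdot>\<^sub>o s"
      by cases (use F in \<open>simp_all add: ord_prod_def split_beta\<close>)
  qed
qed

lemma ord_prod_mono_left:
  assumes "r \<le>o r'" and s: "Well_order s"
  shows "r \<cdot>\<^sub>o s \<le>o r' \<cdot>\<^sub>o s"
proof -
  have r: "Well_order r" and r': "Well_order r'" using assms ordLeq_Well_order_simp by auto
  obtain h where h: "\<And>a. a \<in> Field r \<Longrightarrow> h a \<in> Field r'"
    "\<And>a b. (a, b) \<in> r - Id \<Longrightarrow> (h a, h b) \<in> r' - Id"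
    using ordLeq_strict_mono[OF assms(1)] by metis
  show ?thesis
  proof (rule strict_mono_ordLeq[OF Well_order_ord_prod[OF r s] Well_order_ord_prod[OF r' s],
        where f = "\<lambda>(a, b). (h a, b)"])
    fix p q assume pq: "(p, q) \<in> r \<cdot>\<^sub>o s - Id"
    obtain i j x y where [simp]: "p = (i, j)" "q = (x, y)" by (cases p, cases q)
    show "((\<lambda>(a, b). (h a, b)) p, (\<lambda>(a, b). (h a, b)) q) \<in> r' \<cdot>\<^sub>o s - Id"
      using pq h(1)[of i] h(1)[of x] h(2)[of i x] by (auto simp: ord_prod_def)
  qed (auto simp: Field_ord_prod r r' s h)
qed

text \<open>Locates the occurrence of \<open>x\<close> numbered \<open>n\<close> from zero. It
  serves to find the summand into which an ordinal falls whose coefficient at the exponent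
  \<open>x\<close> is \<open>n\<close>.\<close>

lemma nth_with_count:
  "n < count (mset ps) x \<Longrightarrow> \<exists>j<length ps. ps ! j = x \<and> count (mset (take j ps)) x = n"
proof (induction ps arbitrary: n)
  case (Cons a ps)
  show ?case
  proof (cases "a = x \<and> n = 0")
    case False
    define n' where "n' = (if a = x then n - 1 else n)"
    have "n' < count (mset ps) x" using Cons.prems False by (auto simp: n'_def split: if_splits)
    then obtain j where j: "j < length ps" "ps ! j = x" "count (mset (take j ps)) x = n'"
      using Cons.IH by blast
    then have "Suc j < length (a # ps) \<and> (a # ps) ! Suc j = x \<and>
        count (mset (take (Suc j) (a # ps))) x = n"
      using False by (auto simp: n'_def)
    then show ?thesis by blast
  qed auto
qed simp

lemma count_mset_in_fin_supp: "set ps \<subseteq> Field E \<Longrightarrow> count (mset ps) \<in> fin_supp E"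
  by (auto simp: fin_supp_def simp flip: set_mset_mset)

lemma fin_supp_add: "f \<in> fin_supp E \<Longrightarrow> g \<in> fin_supp E \<Longrightarrow> (\<lambda>x. f x + g x) \<in> fin_supp E"
  by (auto simp: fin_supp_def elim: finite_subset[rotated, OF finite_UnI])

lemma fin_supp_initseg_iff:
  assumes "Well_order E"
  shows "f \<in> fin_supp (initseg E p) \<longleftrightarrow> f \<in> fin_supp E \<and> (\<forall>y. f y \<noteq> 0 \<longrightarrow> (y, p) \<in> E - Id)"
  unfolding fin_supp_def Field_initseg[OF assms] by (auto simp: underS_def Field_def)

text \<open>A position \<open>(j, f)\<close> in the sum stands for the ordinal
  \<open>\<omega>\<^bsup>p\<^sub>0\<^esup> + \<dots> + \<omega>\<^bsup>p\<^sub>j\<^sub>-\<^sub>1\<^esup> + f\<close>, and adding coefficients is ordinal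
  addition here since the exponents are descending.\<close>

lemma ord_sum_omega_pow_initseg:
  assumes E: "Well_order E" and ps: "set ps \<subseteq> Field E"
    and desc: "sorted_wrt (\<lambda>p q. (q, p) \<in> E) ps"
  shows "ord_sum_list (map (\<lambda>p. omega_pow (initseg E p)) ps) =o
    initseg (omega_pow E) (count (mset ps))"
proof -
  let ?S = "ord_sum_list (map (\<lambda>p. omega_pow (initseg E p)) ps)"
  \<comment> \<open>The coefficients of the sum of all summands before position \<open>j\<close>;
    \<open>j\<close> may also be the length of \<open>ps\<close>.\<close>
  define cl where "cl j = count (mset (take j ps))" for j
  define \<Phi> where "\<Phi> = (\<lambda>(j, f) x. cl j x + f x :: nat)"
  have wE: "Well_order (omega_pow E)" by (rule Well_order_omega_pow[OF E])
  have w: "\<forall>r\<in>set (map (\<lambda>p. omega_pow (initseg E p)) ps). Well_order r"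
    using Well_order_omega_pow[OF Well_order_initseg[OF E]] by simp
  then have wS: "Well_order ?S" by (rule Well_order_ord_sum_list)
  have FS: "Field ?S = {(j, f). j < length ps \<and> f \<in> fin_supp (initseg E (ps ! j))}"
    unfolding Field_ord_sum_list[OF w] by (auto simp: Field_omega_pow)
  have nth: "ps ! j \<in> Field E" if "j < length ps" for j using ps that by auto
  have le_nth: "(ps ! k, ps ! j) \<in> E" if "j \<le> k" "k < length ps" for j k
    using desc that Well_order_refl[OF E nth] sorted_wrt_nth_less[OF desc, of j k]
    by (cases "j = k") auto
  have cl_len: "cl (length ps) = count (mset ps)" by (simp add: cl_def)
  have cl_supp: "cl j \<in> fin_supp E" for j
    unfolding cl_def by (rule count_mset_in_fin_supp) (use ps set_take_subset in fast)
  have cl_mono: "cl j x \<le> cl k x" if "j \<le> k" for j k x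
  proof -
    have "take k ps = take j ps @ take (k - j) (drop j ps)"
      using that by (metis le_add_diff_inverse take_add)
    then show ?thesis by (simp add: cl_def)
  qed
  \<comment> \<open>From position \<open>j\<close> on all exponents are at most
    \<open>ps ! j\<close>, so the coefficient of a larger exponent is already complete.\<close>
  have cl_above: "cl j y = cl k y" if "(ps ! j, y) \<in> E - Id" "j \<le> k" "k \<le> length ps" for j k y
  proof -
    have "y \<notin> set (drop j ps)"
    proof
      assume "y \<in> set (drop j ps)"
      then obtain i where "i < length ps - j" "y = ps ! (j + i)" by (auto simp: in_set_conv_nth)
      then have "(y, ps ! j) \<in> E" using le_nth[of j "j + i"] by simp
      then show False using that Well_order_antisym[OF E] by blast
    qed
    moreover have "count (mset ps) y = cl j y + count (mset (drop j ps)) y"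
      unfolding cl_def by (metis append_take_drop_id count_union mset_append)
    ultimately have "cl j y = cl (length ps) y" by (simp add: cl_len)
    then show ?thesis using cl_mono[OF that(2), of y] cl_mono[OF that(3), of y] by simp
  qed
  have cl_at: "cl j (ps ! j) < cl k (ps ! j)" if "j < k" "k \<le> length ps" for j k
  proof -
    have "cl (Suc j) (ps ! j) = Suc (cl j (ps ! j))"
      using that by (simp add: cl_def take_Suc_conv_app_nth)
    then show ?thesis using cl_mono[of "Suc j" k "ps ! j"] that by simp
  qed
  have cl_below: "cl j y = 0" if "(y, ps ! j) \<in> E - Id" "j < length ps" for j y
  proof (rule ccontr)
    assume "cl j y \<noteq> 0"
    then have "y \<in> set (take j ps)" by (simp add: cl_def)
    then obtain i where "i < j" "y = ps ! i" by (auto simp: in_set_conv_nth)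
    then have "(ps ! j, y) \<in> E" using le_nth[of i j] that by simp
    then show False using that Well_order_antisym[OF E] by blast
  qed
  have supp: "\<Phi> (j, f) \<in> fin_supp E" if "f \<in> fin_supp E" for j f
    unfolding \<Phi>_def prod.case by (rule fin_supp_add[OF cl_supp that])
  have zero: "f y = 0" if "f \<in> fin_supp (initseg E p)" "(p, y) \<in> E" for f p y
    using that Well_order_antisym[OF E] unfolding fin_supp_initseg_iff[OF E] by blast
  \<comment> \<open>Passing to a later summand raises the coefficient of \<open>ps ! j\<close>,
    while \<open>f\<close> has only smaller exponents. The case where \<open>k\<close> is the length
    and \<open>g\<close> is zero compares with the total and gives \<open>into\<close>.\<close>
  have fst_less: "(\<Phi> (j, f), \<Phi> (k, g)) \<in> omega_pow E - Id"
    if jk: "j < k" "k \<le> length ps" and f: "f \<in> fin_supp (initseg E (ps ! j))"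
      and g: "g \<in> fin_supp E" "\<And>y. (ps ! j, y) \<in> E - Id \<Longrightarrow> g y = 0" for j k f g
  proof -
    have j: "ps ! j \<in> Field E" using nth jk by simp
    have "\<Phi> (j, f) (ps ! j) < \<Phi> (k, g) (ps ! j)"
      using cl_at[OF jk] zero[OF f Well_order_refl[OF E j]] by (simp add: \<Phi>_def)
    moreover have "\<Phi> (j, f) y = \<Phi> (k, g) y" if "(ps ! j, y) \<in> E" "y \<noteq> ps ! j" for y
      using cl_above[of j y k] zero[OF f that(1)] g(2)[of y] that jk by (simp add: \<Phi>_def)
    moreover have "f \<in> fin_supp E" using f fin_supp_initseg_iff[OF E] by blast
    ultimately show ?thesis using supp g(1) j unfolding omega_pow_strict_iff by blast
  qed
  have top: "\<Phi> (length ps, \<lambda>_. 0) = count (mset ps)"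
    by (simp add: \<Phi>_def cl_len)
  have into: "\<Phi> (j, f) \<in> underS (omega_pow E) (count (mset ps))"
    if "j < length ps" "f \<in> fin_supp (initseg E (ps ! j))" for j f
    using fst_less[OF that(1) order_refl that(2), of "\<lambda>_. 0"]
    unfolding top by (auto simp: underS_def fin_supp_def)
  show ?thesis
  proof (rule strict_mono_onto_ordIso[OF wS Well_order_initseg[OF wE], of \<Phi>])
    show "(\<Phi> p, \<Phi> q) \<in> initseg (omega_pow E) (count (mset ps)) - Id" if "(p, q) \<in> ?S - Id" for p q
    proof -
      obtain j f k g where pq: "p = (j, f)" "q = (k, g)" by (cases p, cases q)
      have jk: "j < length ps" "k < length ps" "f \<in> fin_supp (initseg E (ps ! j))"
        "g \<in> fin_supp (initseg E (ps ! k))" "j < k \<or> j = k \<and> (f, g) \<in> omega_pow (initseg E (ps ! j)) - Id"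
        using that unfolding pq ord_sum_list_strict_iff by (auto simp: Field_omega_pow)
      then have fg: "f \<in> fin_supp E" "g \<in> fin_supp E" using fin_supp_initseg_iff[OF E] by blast+
      from jk(5) have "(\<Phi> (j, f), \<Phi> (k, g)) \<in> omega_pow E - Id"
      proof (elim disjE conjE)
        assume "j < k"
        moreover have "g y = 0" if "(ps ! j, y) \<in> E - Id" for y
        proof (rule zero[OF jk(4)])
          show "(ps ! k, y) \<in> E"
            using le_nth[of j k] \<open>j < k\<close> jk(2) that Well_order_trans[OF E, of "ps ! k" "ps ! j" y] by simp
        qed
        ultimately show ?thesis using fst_less[of j k f g] jk fg by simp
      next
        assume "j = k" "(f, g) \<in> omega_pow (initseg E (ps ! j)) - Id"
        then obtain x where x: "x \<in> underS E (ps ! j)" "f x < g x"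
          "\<And>y. (x, y) \<in> initseg E (ps ! j) \<Longrightarrow> y \<noteq> x \<Longrightarrow> f y = g y"
          unfolding omega_pow_strict_iff Field_initseg[OF E] by blast
        have "f y = g y" if "(x, y) \<in> E" "y \<noteq> x" for y
        proof (cases "y \<in> underS E (ps ! j)")
          case True
          then show ?thesis using x(1,3) that by blast
        next
          case False
          have "y \<in> Field E" using that by (auto simp: Field_def)
          then have "(ps ! j, y) \<in> E"
            using Well_order_linear[OF E nth[OF jk(1)], of y] False by (auto simp: underS_def)
          then show ?thesis using zero jk(3,4) \<open>j = k\<close> by metis
        qed
        moreover have "x \<in> Field E" using x(1) by (auto simp: underS_def Field_def)
        ultimately show ?thesis
          using x(2) supp fg \<open>j = k\<close> unfolding omega_pow_strict_iff by (auto simp: \<Phi>_def intro!: bexI[of _ x])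
      qed
      then show ?thesis using into jk unfolding pq by blast
    qed
  next
    have onto: "\<exists>q\<in>Field ?S. \<Phi> q = h" if "h \<in> underS (omega_pow E) (count (mset ps))" for h
    proof -
      have "(h, count (mset ps)) \<in> omega_pow E - Id" using that by (auto simp: underS_def)
      then obtain x where h: "h \<in> fin_supp E" and x: "x \<in> Field E" "h x < count (mset ps) x"
        "\<And>y. (x, y) \<in> E \<Longrightarrow> y \<noteq> x \<Longrightarrow> h y = count (mset ps) y"
        unfolding omega_pow_strict_iff by blast
      \<comment> \<open>At the largest exponent \<open>x\<close> where \<open>h\<close> drops below
        the total, the coefficient \<open>h x\<close> tells how many copies of \<open>x\<close> are
        used up; the next copy is the summand that contains \<open>h\<close>, and the coefficients
        of \<open>h\<close> below \<open>x\<close> are the position inside it.\<close>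
      obtain j where j: "j < length ps" "ps ! j = x" "cl j x = h x"
        using nth_with_count[OF x(2)] unfolding cl_def by blast
      define f where "f = (\<lambda>y. if (y, x) \<in> E - Id then h y else 0)"
      have "{y. f y \<noteq> 0} \<subseteq> {y. h y \<noteq> 0}" by (auto simp: f_def)
      then have "f \<in> fin_supp E" using h by (auto simp: fin_supp_def intro: finite_subset)
      then have f: "f \<in> fin_supp (initseg E (ps ! j))"
        unfolding fin_supp_initseg_iff[OF E] j(2) by (auto simp: f_def)
      have "\<Phi> (j, f) y = h y" for y
      proof (cases "y \<in> Field E")
        case True
        show ?thesis
        proof (rule Well_order_cases[OF E True x(1)])
          assume "(y, x) \<in> E - Id"
          then show ?thesis using cl_below[of y j] j by (auto simp: \<Phi>_def f_def)
        next
          assume "y = x"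
          then show ?thesis using j by (simp add: \<Phi>_def f_def)
        next
          assume greater: "(x, y) \<in> E - Id"
          then have "(y, x) \<notin> E - Id" using Well_order_antisym[OF E] by blast
          then show ?thesis using cl_above[of j y "length ps"] greater x(3)[of y] j cl_len
            by (auto simp: \<Phi>_def f_def)
        qed
      next
        case False
        then show ?thesis using fin_supp_outside[OF cl_supp False] fin_supp_outside[OF h False]
          by (auto simp: \<Phi>_def f_def)
      qed
      then show ?thesis using j(1) f FS by (intro bexI[of _ "(j, f)"]) auto
    qed
    show "\<Phi> ` Field ?S = Field (initseg (omega_pow E) (count (mset ps)))"
      unfolding Field_initseg[OF wE]
    proof
      show "\<Phi> ` Field ?S \<subseteq> underS (omega_pow E) (count (mset ps))"
        using into unfolding FS by blast
      show "underS (omega_pow E) (count (mset ps)) \<subseteq> \<Phi> ` Field ?S" using onto by blast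
    qed
  qed
qed

subsection \<open>Cantor normal forms\<close>

definition exponent :: "'a rel \<Rightarrow> 'b rel \<Rightarrow> 'a" where
  "exponent E e = (SOME p. p \<in> Field E \<and> e =o initseg E p)"

lemma ordIso_cong_left:
  assumes "d =o e"
  shows "d =o s \<longleftrightarrow> e =o s"
  using ordIso_transitive[OF assms, of s] ordIso_transitive[OF ordIso_symmetric[OF assms], of s]
  by blast

text \<open>Isomorphic exponents satisfy the same predicate under \<open>SOME\<close>, so they are
  assigned the same element of \<open>E\<close>, even when their types differ. This turns
  \<open>=o\<close> into equality.\<close>

lemma exponent_cong:
  assumes "d =o e"
  shows "exponent E d = exponent E e"
proof -
  show ?thesis unfolding exponent_def ordIso_cong_left[OF assms] ..
qed

lemma exponent_in_Field: "e <o E \<Longrightarrow> exponent E e \<in> Field E"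
  and exponent_ordIso: "e <o E \<Longrightarrow> e =o initseg E (exponent E e)"
proof -
  assume less: "e <o E"
  then have "\<exists>p. p \<in> Field E \<and> e =o initseg E p"
    using ordLess_iff_ordIso_Restr[of E e] unfolding ordLess_def by blast
  from someI_ex[OF this] show "exponent E e \<in> Field E" "e =o initseg E (exponent E e)"
    unfolding exponent_def by auto
qed

text \<open>A well-order on \<open>'a\<close> has at most as many elements as the type, so it cannot
  reach the successor cardinal. One \<open>E\<close> thus exceeds all exponents on the type at
  once.\<close>

lemma ordLess_cardSuc_UNIV:
  fixes e :: "'a rel"
  assumes "Well_order e"
  shows "e <o cardSuc |UNIV :: 'a set|"
proof (rule ccontr)
  let ?E = "cardSuc |UNIV :: 'a set|"
  have E: "Card_order ?E" by (rule cardSuc_Card_order[OF card_of_Card_order])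
  assume "\<not> e <o ?E"
  then have "?E \<le>o e"
    using assms E not_ordLess_iff_ordLeq card_order_on_well_order_on by blast
  then have "|Field ?E| \<le>o |Field e|" by (rule card_of_mono2)
  also have "|Field e| \<le>o |UNIV :: 'a set|" by (rule card_of_mono1) simp
  also have "|UNIV :: 'a set| <o ?E" by (rule cardSuc_greater[OF card_of_Card_order])
  finally have "|Field ?E| <o ?E" .
  then show False using card_of_Field_ordIso[OF E] not_ordLess_ordIso by blast
qed

lemma ord_sum_omega_pow_exponents:
  assumes E: "Well_order E" and es: "\<forall>e\<in>set es. e <o E" and desc: "descending es"
  shows "ord_sum_list (map omega_pow es) =o
    initseg (omega_pow E) (count (mset (map (exponent E) es)))"
proof -
  let ?c = "exponent E"
  have "list_all2 (\<lambda>r s. r =o s) (map omega_pow es) (map (\<lambda>p. omega_pow (initseg E p)) (map ?c es))"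
    using es by (auto simp: list_all2_conv_all_nth intro!: omega_pow_cong exponent_ordIso)
  then have "ord_sum_list (map omega_pow es) =o
      ord_sum_list (map (\<lambda>p. omega_pow (initseg E p)) (map ?c es))"
    by (rule ord_sum_list_cong)
  also have "ord_sum_list (map (\<lambda>p. omega_pow (initseg E p)) (map ?c es)) =o
      initseg (omega_pow E) (count (mset (map ?c es)))"
  proof (rule ord_sum_omega_pow_initseg[OF E])
    show "set (map ?c es) \<subseteq> Field E" using es exponent_in_Field by fastforce
    have "(?c e, ?c d) \<in> E" if "d \<in> set es" "e \<in> set es" "e \<le>o d" for d e
    proof -
      have "initseg E (?c e) \<le>o initseg E (?c d)"
        using es that exponent_ordIso ordIso_ordLeq_trans ordLeq_ordIso_trans ordIso_symmetric
        by metis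
      then show ?thesis using initseg_ordLeq_iff[OF E] es that exponent_in_Field by metis
    qed
    then show "sorted_wrt (\<lambda>p q. (q, p) \<in> E) (map ?c es)"
      unfolding sorted_wrt_map using desc by (rule sorted_wrt_mono_rel)
  qed
  finally show ?thesis .
qed

text \<open>Inside \<open>omega_pow E\<close> both sums are the initial segment given by the same
  multiset of elements of \<open>E\<close>. This absorbs the change of type, the replacement of
  exponents by isomorphic ones and the order in which \<open>sort_desc\<close> puts ties.\<close>

lemma ord_sum_omega_pow_perm:
  fixes es :: "'b rel list" and ds :: "'c rel list"
  assumes "\<forall>e\<in>set es. Well_order e" "descending es" "descending ds"
    and xs: "list_all2 (\<lambda>x e. x =o e) xs es" "mset ds = mset xs"
  shows "ord_sum_list (map omega_pow ds) =o ord_sum_list (map omega_pow es)"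
proof -
  define E where "E = cardSuc |UNIV :: 'b set|"
  have E: "Well_order E"
    using cardSuc_Card_order[OF card_of_Card_order] card_order_on_well_order_on unfolding E_def by blast
  have es: "\<forall>e\<in>set es. e <o E" using assms(1) ordLess_cardSuc_UNIV unfolding E_def by blast
  have "x <o E" if x: "x \<in> set xs" for x
  proof -
    obtain i where "i < length xs" "x = xs ! i" using x by (auto simp: in_set_conv_nth)
    then have "x =o es ! i" "es ! i \<in> set es" using xs(1) by (auto simp: list_all2_conv_all_nth)
    then show ?thesis using es ordIso_ordLess_trans by blast
  qed
  then have ds: "\<forall>d\<in>set ds. d <o E" using xs(2) mset_eq_setD by blast
  have "map (exponent E) xs = map (exponent E) es"
    using xs(1) by (induction rule: list_all2_induct) (simp_all add: exponent_cong)
  then have eq: "mset (map (exponent E) ds) = mset (map (exponent E) es)"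
    using xs(2) by (metis mset_map)
  show ?thesis
    by (rule ordIso_transitive[OF ord_sum_omega_pow_exponents[OF E ds assms(3), unfolded eq]
        ordIso_symmetric[OF ord_sum_omega_pow_exponents[OF E es assms(2)]]])
qed

text \<open>Insertion sort for a relation that is assumed transitive and total only on the given
  elements and need not be antisymmetric, such as \<open>\<le>o\<close> on well-orders.\<close>

lemma ex_sorted_wrt_mset:
  assumes "\<And>x y z. \<lbrakk>x \<in># M; y \<in># M; z \<in># M; R x y; R y z\<rbrakk> \<Longrightarrow> R x z"
    and "\<And>x y. \<lbrakk>x \<in># M; y \<in># M\<rbrakk> \<Longrightarrow> R x y \<or> R y x"
  shows "\<exists>ps. mset ps = M \<and> sorted_wrt R ps"
  using assms
proof (induction M)
  case (add x M)
  have "\<exists>ps. mset ps = M \<and> sorted_wrt R ps"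
  proof (rule add.IH)
    show "R u w" if "u \<in># M" "v \<in># M" "w \<in># M" "R u v" "R v w" for u v w
      using add.prems(1)[of u v w] that by simp
    show "R u v \<or> R v u" if "u \<in># M" "v \<in># M" for u v
      using add.prems(2)[of u v] that by simp
  qed
  then obtain ps where ps: "mset ps = M" "sorted_wrt R ps" by blast
  let ?a = "filter (\<lambda>y. R y x) ps" and ?b = "filter (\<lambda>y. \<not> R y x) ps"
  have in_M: "y \<in># add_mset x M" if "y \<in> set (x # ps)" for y using that ps(1) by auto
  have b: "R x z" if "z \<in> set ?b" for z using that add.prems(2)[of x z] in_M by auto
  have "\<forall>z\<in>set ?b. R x z" using b by blast
  moreover have "\<forall>y\<in>set ?a. \<forall>z\<in>set (x # ?b). R y z"
  proof (intro ballI)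
    fix y z assume y: "y \<in> set ?a" and z: "z \<in> set (x # ?b)"
    then have yx: "R y x" by simp
    show "R y z"
    proof (cases "z = x")
      case False
      then have "R x z" using b z by auto
      then show ?thesis using add.prems(1)[of y x z] yx y z in_M by auto
    qed (simp add: yx)
  qed
  moreover have "sorted_wrt R ?a" "sorted_wrt R ?b" using ps(2) by (simp_all add: sorted_wrt_filter)
  ultimately have "sorted_wrt R (?a @ x # ?b)"
    unfolding sorted_wrt_append sorted_wrt.simps by blast
  moreover have "mset (?a @ x # ?b) = add_mset x M"
    using ps(1) by (simp add: mset_filter)
  ultimately show ?case by blast
qed auto

lemma sort_desc:
  assumes "\<forall>e\<in>set es. Well_order e"
  shows "mset (sort_desc es) = mset es" "descending (sort_desc es)"
proof -
  have "\<exists>ds. mset ds = mset es \<and> descending ds"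
  proof (rule ex_sorted_wrt_mset)
    show "z \<le>o x" if "y \<le>o x" "z \<le>o y" for x y z using that ordLeq_transitive by blast
    show "y \<le>o x \<or> x \<le>o y" if "x \<in># mset es" "y \<in># mset es" for x y
      using that assms ordLeq_total by auto
  qed
  from someI_ex[OF this] show "mset (sort_desc es) = mset es" "descending (sort_desc es)"
    unfolding sort_desc_def by auto
qed

lemma ord_sum_list_singleton:
  assumes "Well_order r"
  shows "r =o ord_sum_list [r]"
proof (rule strict_mono_onto_ordIso[OF assms, where f = "Pair 0"])
  show "Well_order (ord_sum_list [r])" by (rule Well_order_ord_sum_list) (simp add: assms)
  show "Pair 0 ` Field r = Field (ord_sum_list [r])"
    using assms by (subst Field_ord_sum_list) auto
qed (auto simp: ord_sum_list_def FieldI1 FieldI2)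

section \<open>Existence of Cantor normal forms\<close>

lemma ordLeq_omega_pow:
  assumes "Well_order r"
  shows "r \<le>o omega_pow r"
proof (rule strict_mono_ordLeq[OF assms Well_order_omega_pow[OF assms]])
  let ?f = "\<lambda>a x. if x = a then 1 else 0 :: nat"
  have supp: "?f a \<in> fin_supp r" if "a \<in> Field r" for a
    using that by (auto simp: fin_supp_def)
  then show "?f a \<in> Field (omega_pow r)" if "a \<in> Field r" for a
    using that by (simp add: Field_omega_pow)
  show "(?f a, ?f b) \<in> omega_pow r - Id" if ab: "(a, b) \<in> r - Id" for a b
  proof -
    have F: "a \<in> Field r" "b \<in> Field r" using ab by (auto simp: Field_def)
    have "?f a y = ?f b y" if "(b, y) \<in> r" "y \<noteq> b" for y
      using that ab Well_order_antisym[OF assms] by auto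
    moreover have "?f a b < ?f b b" using ab by auto
    ultimately show ?thesis
      using supp[OF F(1)] supp[OF F(2)] F unfolding omega_pow_strict_iff by blast
  qed
qed

text \<open>Since \<open>r\<close> embeds into \<open>\<omega>\<^sup>r\<close> by \<open>a \<mapsto> \<omega>\<^sup>a\<close>, it is either \<open>\<omega>\<^sup>r\<close> itself or the set of predecessors
  of an element of \<open>\<omega>\<^sup>r\<close>, whose coefficients are those of the Cantor normal form.\<close>

lemma ex_cnf:
  assumes r: "Well_order r"
  shows "\<exists>es :: 'a rel list. (\<forall>e\<in>set es. Well_order e) \<and> descending es \<and>
    (r :: 'a rel) =o ord_sum_list (map omega_pow es)"
proof (cases "r =o omega_pow r")
  \<comment> \<open>The fixed points of exponentiation (epsilon numbers) have themselves as their
    only exponent.\<close>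
  case True
  also have "omega_pow r =o ord_sum_list [omega_pow r]"
    by (rule ord_sum_list_singleton[OF Well_order_omega_pow[OF r]])
  finally show ?thesis using r by (intro exI[of _ "[r]"]) simp
next
  case False
  then have "r <o omega_pow r" using ordLeq_omega_pow[OF r] ordLeq_iff_ordLess_or_ordIso by blast
  then obtain h where h: "h \<in> fin_supp r" "r =o initseg (omega_pow r) h"
    using ordLess_iff_ordIso_Restr[OF Well_order_omega_pow[OF r] r] unfolding Field_omega_pow by blast
  have cnt: "count (Abs_multiset h) = h" using h(1) by (simp add: fin_supp_def)
  have sub: "set_mset (Abs_multiset h) \<subseteq> Field r"
    using h(1) by (auto simp: set_mset_def cnt fin_supp_def)
  have "\<exists>ps. mset ps = Abs_multiset h \<and> sorted_wrt (\<lambda>p q. (q, p) \<in> r) ps"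
  proof (rule ex_sorted_wrt_mset)
    show "(z, x) \<in> r" if "(y, x) \<in> r" "(z, y) \<in> r" for x y z
      using Well_order_trans[OF r that(2,1)] .
    show "(y, x) \<in> r \<or> (x, y) \<in> r" if "x \<in># Abs_multiset h" "y \<in># Abs_multiset h" for x y
      using Well_order_linear[OF r, of x y] sub that by blast
  qed
  then obtain ps where ps: "mset ps = Abs_multiset h" "sorted_wrt (\<lambda>p q. (q, p) \<in> r) ps"
    by blast
  have F: "set ps \<subseteq> Field r" using sub ps(1) by (metis set_mset_mset)
  have "r =o ord_sum_list (map omega_pow (map (initseg r) ps))"
    using ordIso_transitive[OF h(2) ordIso_symmetric[OF ord_sum_omega_pow_initseg[OF r F ps(2),
          unfolded ps(1) cnt]]]
    by (simp add: comp_def)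
  moreover have "descending (map (initseg r) ps)"
    unfolding sorted_wrt_map
  proof (rule sorted_wrt_mono_rel[OF _ ps(2)])
    fix p q assume "p \<in> set ps" "q \<in> set ps" "(q, p) \<in> r"
    then show "initseg r q \<le>o initseg r p" using F initseg_ordLeq_iff[OF r, of q p] by blast
  qed
  moreover have "\<forall>e\<in>set (map (initseg r) ps). Well_order e" using Well_order_initseg[OF r] by simp
  ultimately show ?thesis by blast
qed

lemma cnf:
  assumes "Well_order r"
  shows "\<forall>e\<in>set (cnf r). Well_order e" "descending (cnf r)"
    "r =o ord_sum_list (map omega_pow (cnf r))"
  using someI_ex[OF ex_cnf[OF assms]] unfolding cnf_def by auto

section \<open>Normal forms of finite ordinals and natural products with them\<close>

lemma zero_in_fin_supp: "(\<lambda>_. 0) \<in> fin_supp r"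
  by (simp add: fin_supp_def)

lemma Field_ord_sum_omega_pow:
  assumes "\<forall>e\<in>set es. Well_order e"
  shows "Field (ord_sum_list (map omega_pow es)) = {(i, f). i < length es \<and> f \<in> fin_supp (es ! i)}"
proof -
  have "\<forall>r\<in>set (map omega_pow es). Well_order r" using assms Well_order_omega_pow by auto
  then show ?thesis by (auto simp: Field_ord_sum_list Field_omega_pow)
qed

text \<open>Every power of omega contains the zero function, so a nonempty list of exponents never
  sums to zero.\<close>

lemma cnf_empty: "cnf {} = []"
proof -
  have w: "Well_order {}" by (simp add: well_order_on_def linear_order_on_def)
  obtain f where "bij_betw f (Field ({} :: 'a rel)) (Field (ord_sum_list (map omega_pow (cnf ({} :: 'a rel)))))"
    by (rule ordIso_bij_betw[OF cnf(3)[OF w]])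
  then have F: "{(i, f). i < length (cnf ({} :: 'a rel)) \<and> f \<in> fin_supp (cnf ({} :: 'a rel) ! i)} = {}"
    unfolding Field_ord_sum_omega_pow[OF cnf(1)[OF w]] by (simp add: bij_betw_def)
  have "\<not> 0 < length (cnf ({} :: 'a rel))"
  proof
    assume "0 < length (cnf ({} :: 'a rel))"
    then have "(0, \<lambda>_. 0) \<in> {(i, f). i < length (cnf ({} :: 'a rel)) \<and> f \<in> fin_supp (cnf ({} :: 'a rel) ! i)}"
      by (simp add: zero_in_fin_supp)
    then show False using F by blast
  qed
  then show ?thesis by simp
qed

text \<open>Zero contributes no exponents; what remains are those of \<open>r\<close>, relabelled by
  \<open>Inl\<close> and sorted again.\<close>

lemma nat_sum_empty:
  assumes "Well_order r"
  shows "r \<oplus>\<^sub>o {} =o r"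
proof -
  let ?xs = "map (\<lambda>e. dir_image e Inl) (cnf r) :: ('a + 'b) rel list"
  have w: "\<forall>e\<in>set ?xs. Well_order e" using cnf(1)[OF assms] Well_order_dir_image[of _ Inl] by auto
  have "list_all2 (\<lambda>x e. x =o e) ?xs (cnf r)"
    unfolding list.rel_map
  proof (rule list.rel_refl_strong)
    fix e assume "e \<in> set (cnf r)"
    then have "e =o dir_image e Inl" using cnf(1)[OF assms] by (intro dir_image_ordIso) auto
    then show "dir_image e Inl =o e" by (rule ordIso_symmetric)
  qed
  then have "r \<oplus>\<^sub>o ({} :: 'b rel) =o ord_sum_list (map omega_pow (cnf r))"
    unfolding nat_sum_def cnf_empty using cnf[OF assms] sort_desc[OF w]
    by (auto intro: ord_sum_omega_pow_perm)
  from ordIso_transitive[OF this ordIso_symmetric[OF cnf(3)[OF assms]]] show ?thesis .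
qed

text \<open>A point in one of the exponents would give infinitely many functions in a finite sum, so
  all exponents are zero. Each summand then has one element, and counting gives \<open>m\<close> of
  them.\<close>

lemma cnf_natLeq_on: "cnf (natLeq_on m) = replicate m {}"
proof -
  let ?fs = "cnf (natLeq_on m)"
  let ?S = "{(i, f). i < length ?fs \<and> f \<in> fin_supp (?fs ! i)}"
  have w: "Well_order (natLeq_on m)" by (rule natLeq_on_Well_order)
  obtain b where "bij_betw b (Field (natLeq_on m)) (Field (ord_sum_list (map omega_pow ?fs)))"
    by (rule ordIso_bij_betw[OF cnf(3)[OF w]])
  then have b: "bij_betw b {x. x < m} ?S"
    unfolding Field_ord_sum_omega_pow[OF cnf(1)[OF w]] Field_natLeq_on .
  have fin: "finite ?S" using bij_betw_finite[OF b] by simp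
  have empty: "?fs ! i = {}" if i: "i < length ?fs" for i
  proof (rule ccontr)
    assume "?fs ! i \<noteq> {}"
    then obtain x y where "(x, y) \<in> ?fs ! i" by auto
    then have x: "x \<in> Field (?fs ! i)" by (rule FieldI1)
    define g where "g = (\<lambda>n :: nat. (i, \<lambda>y. if y = x then n else 0))"
    have "inj g"
    proof (rule injI)
      fix k n assume "g k = g n"
      then have "snd (g k) x = snd (g n) x" by simp
      then show "k = n" by (simp add: g_def)
    qed
    moreover have "range g \<subseteq> ?S" using i x by (auto simp: g_def fin_supp_def split: if_splits)
    then have "finite (range g)" using fin by (rule finite_subset)
    ultimately show False using finite_imageD[of g UNIV] by simp
  qed
  have "?S = {..<length ?fs} \<times> {\<lambda>_. 0}"
    by (auto simp: empty fin_supp_def)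
  then have "length ?fs = m" using bij_betw_same_card[OF b] by (simp add: card_cartesian_product)
  then show ?thesis using empty by (intro nth_equalityI) auto
qed

lemma descending_concat_replicate:
  "descending es \<Longrightarrow> \<forall>e\<in>set es. Well_order e \<Longrightarrow> descending (concat (map (replicate m) es))"
proof (induction es)
  case (Cons e es)
  have "descending (replicate k e)" for k
    using Cons.prems by (induction k) (auto intro: ordLeq_reflexive)
  then show ?case using Cons by (auto simp: sorted_wrt_append)
qed simp

text \<open>As \<open>m\<close> has \<open>m\<close> exponents, all zero, each exponent
  \<open>e\<close> of \<open>r\<close> meets \<open>m\<close> of them and is repeated
  \<open>m\<close> times, up to isomorphism.\<close>

lemma nat_prod_natLeq_on:
  assumes r: "Well_order r"
  shows "r \<otimes>\<^sub>o natLeq_on m =o ord_sum_list (map omega_pow (concat (map (replicate m) (cnf r))))"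
proof -
  let ?xs = "[e \<oplus>\<^sub>o f. e \<leftarrow> cnf r, f \<leftarrow> cnf (natLeq_on m)]"
  let ?es = "concat (map (replicate m) (cnf r))"
  have xs: "?xs = concat (map (\<lambda>e. replicate m (e \<oplus>\<^sub>o ({} :: nat rel))) (cnf r))"
    by (simp add: cnf_natLeq_on)
  have sum: "e \<oplus>\<^sub>o ({} :: nat rel) =o e" if "e \<in> set (cnf r)" for e
    using nat_sum_empty cnf(1)[OF r] that by blast
  have rel: "list_all2 (\<lambda>x e. x =o e) (concat (map (\<lambda>e. replicate m (e \<oplus>\<^sub>o ({} :: nat rel))) es))
      (concat (map (replicate m) es))" if "set es \<subseteq> set (cnf r)" for es
    using that
  proof (induction es)
    case (Cons e es)
    then have "list_all2 (\<lambda>x e. x =o e) (replicate m (e \<oplus>\<^sub>o ({} :: nat rel))) (replicate m e)"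
      using sum by (simp add: list_all2_conv_all_nth)
    then show ?case using Cons by (simp add: list_all2_appendI)
  qed simp
  have w: "\<forall>e\<in>set ?es. Well_order e" using cnf(1)[OF r] by auto
  have "\<forall>x\<in>set ?xs. Well_order x" unfolding xs using sum by (auto simp: ordIso_def)
  note sd = sort_desc[OF this]
  have "list_all2 (\<lambda>x e. x =o e) ?xs ?es" unfolding xs by (rule rel) simp
  from ord_sum_omega_pow_perm[OF w descending_concat_replicate[OF cnf(2,1)[OF r]] sd(2) this sd(1)]
  show ?thesis unfolding nat_prod_def .
qed

subsection \<open>Ranks of trees\<close>

lemma ranked_byI:
  assumes "\<And>s. s \<in> T \<Longrightarrow> f s \<in> Field \<gamma>"
    and "\<And>s t. s \<in> T \<Longrightarrow> t \<in> T \<Longrightarrow> strict_prefix s t \<Longrightarrow> (f t, f s) \<in> \<gamma> - Id"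
  shows "ranked_by T \<gamma>"
  unfolding ranked_by_def using assms by (intro exI[of _ f]) blast

lemma ranked_by_iff:
  "ranked_by T \<gamma> \<longleftrightarrow> (\<exists>f. (\<forall>s\<in>T. f s \<in> Field \<gamma>) \<and>
     (\<forall>s\<in>T. \<forall>t\<in>T. strict_prefix s t \<longrightarrow> (f t, f s) \<in> \<gamma> - Id))"
  unfolding ranked_by_def image_subset_iff by simp

lemma ranked_by_subset:
  assumes "ranked_by T \<gamma>" "S \<subseteq> T"
  shows "ranked_by S \<gamma>"
proof -
  obtain f where "\<forall>s\<in>T. f s \<in> Field \<gamma>"
    "\<forall>s\<in>T. \<forall>t\<in>T. strict_prefix s t \<longrightarrow> (f t, f s) \<in> \<gamma> - Id"
    using assms(1) unfolding ranked_by_iff by (elim exE conjE)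
  note f = this[rule_format]
  show ?thesis by (rule ranked_byI[where f = f]) (use f assms(2) in \<open>simp_all add: subset_iff\<close>)
qed

text \<open>Makes the minimum over well-orders on \<open>'a list\<close> a minimum over all types:
  \<open>\<gamma>\<close> is cut down to the values of a ranking, and each value is replaced by a
  node that attains it.\<close>

lemma tree_rank:
  fixes T :: "'a list set" and \<gamma> :: "'b rel"
  assumes \<gamma>: "Well_order \<gamma>" and ranked: "ranked_by T \<gamma>"
  shows "Well_order (tree_rank T)" "ranked_by T (tree_rank T)" "tree_rank T \<le>o \<gamma>"
proof -
  obtain f where "\<forall>s\<in>T. f s \<in> Field \<gamma>"
    "\<forall>s\<in>T. \<forall>t\<in>T. strict_prefix s t \<longrightarrow> (f t, f s) \<in> \<gamma> - Id"
    using ranked unfolding ranked_by_iff by (elim exE conjE)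
  note f = this[rule_format]
  define \<rho> where "\<rho> = Restr \<gamma> (f ` T)"
  define \<delta> where "\<delta> = dir_image \<rho> (inv_into T f)"
  have \<rho>: "Well_order \<rho>" unfolding \<rho>_def by (rule Well_order_Restr[OF \<gamma>])
  have F\<rho>: "Field \<rho> = f ` T"
    unfolding \<rho>_def by (rule Field_Restr_subset_eq[OF \<gamma>]) (use f in auto)
  have inj: "inj_on (inv_into T f) (Field \<rho>)" unfolding F\<rho> by (rule inj_on_inv_into) simp
  have \<delta>: "Well_order \<delta>" unfolding \<delta>_def by (rule Well_order_dir_image[OF \<rho> inj])
  have "\<delta> =o \<rho>" unfolding \<delta>_def using dir_image_ordIso[OF \<rho> inj] by (rule ordIso_symmetric)
  moreover have "\<rho> \<le>o \<gamma>"
    by (rule strict_mono_ordLeq[OF \<rho> \<gamma>, of id]) (use f in \<open>auto simp: F\<rho>, auto simp: \<rho>_def\<close>)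
  ultimately have le: "\<delta> \<le>o \<gamma>" by (rule ordIso_ordLeq_trans)
  have "ranked_by T \<delta>"
  proof (rule ranked_byI)
    let ?g = "\<lambda>s. inv_into T f (f s)"
    show "?g s \<in> Field \<delta>" if "s \<in> T" for s
      using that unfolding \<delta>_def dir_image_Field F\<rho> by blast
    fix s t assume st: "s \<in> T" "t \<in> T" "strict_prefix s t"
    then have "(f t, f s) \<in> \<rho> - Id" using f(2) unfolding \<rho>_def by blast
    moreover from this have "?g t \<noteq> ?g s" using inj st F\<rho> by (auto simp: inj_on_def)
    ultimately show "(?g t, ?g s) \<in> \<delta> - Id" unfolding \<delta>_def dir_image_def by blast
  qed
  then have "{\<delta>. Well_order \<delta> \<and> ranked_by T (\<delta> :: 'a list rel)} \<noteq> {}" using \<delta> by blast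
  then have "\<exists>\<gamma> :: 'a list rel. Well_order \<gamma> \<and> ranked_by T \<gamma> \<and>
      (\<forall>\<delta> :: 'a list rel. Well_order \<delta> \<longrightarrow> ranked_by T \<delta> \<longrightarrow> \<gamma> \<le>o \<delta>)"
    using exists_minim_Well_order[of "{\<delta>. Well_order \<delta> \<and> ranked_by T (\<delta> :: 'a list rel)}"] by blast
  from someI_ex[OF this] have *: "Well_order (tree_rank T)" "ranked_by T (tree_rank T)"
    "\<And>\<delta> :: 'a list rel. Well_order \<delta> \<Longrightarrow> ranked_by T \<delta> \<Longrightarrow> tree_rank T \<le>o \<delta>"
    unfolding tree_rank_def by auto
  show "Well_order (tree_rank T)" "ranked_by T (tree_rank T)" by fact+
  show "tree_rank T \<le>o \<gamma>"
    using ordLeq_transitive[OF *(3)[OF \<delta> \<open>ranked_by T \<delta>\<close>] le] .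
qed

text \<open>The relation \<open>R a s\<close> stands for: the node \<open>s\<close> has rank at least \<open>a\<close>.\<close>

definition simulated_in :: "'b rel \<Rightarrow> 'a list set \<Rightarrow> ('b \<Rightarrow> 'a list \<Rightarrow> bool) \<Rightarrow> bool" where
  "simulated_in \<alpha> T R \<longleftrightarrow> (\<forall>a\<in>Field \<alpha>. \<exists>s\<in>T. R a s) \<and>
     (\<forall>a s b. R a s \<longrightarrow> (b, a) \<in> \<alpha> - Id \<longrightarrow> (\<exists>t\<in>T. strict_prefix s t \<and> R b t))"

text \<open>Send \<open>a\<close> to the least value that the ranking \<open>f\<close> takes on
  nodes related to \<open>a\<close>. For \<open>b\<close> below \<open>a\<close>, a proper extension
  of a minimising node is related to \<open>b\<close> and has a smaller value.\<close>

lemma simulated_in_ordLeq: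
  assumes \<alpha>: "Well_order \<alpha>" and \<gamma>: "Well_order \<gamma>" and "ranked_by T \<gamma>"
    and R: "simulated_in \<alpha> T R"
  shows "\<alpha> \<le>o \<gamma>"
proof -
  obtain f where "\<forall>s\<in>T. f s \<in> Field \<gamma>"
    "\<forall>s\<in>T. \<forall>t\<in>T. strict_prefix s t \<longrightarrow> (f t, f s) \<in> \<gamma> - Id"
    using assms(3) unfolding ranked_by_iff by (elim exE conjE)
  note f = this[rule_format]
  have "\<exists>m\<in>f ` {s \<in> T. R a s}. \<forall>x\<in>f ` {s \<in> T. R a s}. (m, x) \<in> \<gamma>"
    if "a \<in> Field \<alpha>" for a
  proof (rule Well_order_ex_least[OF \<gamma>])
    show "f ` {s \<in> T. R a s} \<subseteq> Field \<gamma>" using f(1) by blast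
    show "f ` {s \<in> T. R a s} \<noteq> {}" using R that unfolding simulated_in_def by blast
  qed
  then have "\<forall>a\<in>Field \<alpha>. \<exists>m. m \<in> f ` {s \<in> T. R a s} \<and> (\<forall>x\<in>f ` {s \<in> T. R a s}. (m, x) \<in> \<gamma>)"
    by blast
  then obtain h where *: "\<forall>a\<in>Field \<alpha>. h a \<in> f ` {s \<in> T. R a s} \<and>
      (\<forall>x\<in>f ` {s \<in> T. R a s}. (h a, x) \<in> \<gamma>)"
    unfolding bchoice_iff by (elim exE)
  have h: "\<And>a. a \<in> Field \<alpha> \<Longrightarrow> h a \<in> f ` {s \<in> T. R a s}"
    "\<And>a s. a \<in> Field \<alpha> \<Longrightarrow> s \<in> T \<Longrightarrow> R a s \<Longrightarrow> (h a, f s) \<in> \<gamma>"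
    using * by blast+
  show ?thesis
  proof (rule strict_mono_ordLeq[OF \<alpha> \<gamma>])
    show "h a \<in> Field \<gamma>" if "a \<in> Field \<alpha>" for a using h(1)[OF that] f(1) by auto
    fix b a assume ba: "(b, a) \<in> \<alpha> - Id"
    then have F: "a \<in> Field \<alpha>" "b \<in> Field \<alpha>" by (auto simp: Field_def)
    obtain s where s: "s \<in> T" "R a s" "h a = f s" using h(1)[OF F(1)] by auto
    obtain t where t: "t \<in> T" "strict_prefix s t" "R b t"
      using R s(2) ba unfolding simulated_in_def by blast
    show "(h b, h a) \<in> \<gamma> - Id"
      using Well_order_le_strict_trans[OF \<gamma> h(2)[OF F(2) t(1,3)] f(2)[OF s(1) t(1,2)]]
      unfolding s(3) .
  qed
qed

inductive rank_ge :: "'b rel \<Rightarrow> 'a list set \<Rightarrow> 'b \<Rightarrow> 'a list \<Rightarrow> bool" for \<alpha> T where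
  "(\<And>b. (b, a) \<in> \<alpha> - Id \<Longrightarrow> \<exists>t\<in>T. strict_prefix s t \<and> rank_ge \<alpha> T b t) \<Longrightarrow> rank_ge \<alpha> T a s"

text \<open>Suppose that no node has rank at least \<open>a\<close>. The least \<open>b\<close> such
  that no proper extension of \<open>s\<close> has rank at least \<open>b\<close> is then defined
  for every \<open>s\<close>; these values rank the tree below \<open>a\<close>, against the
  minimality of \<open>tree_rank\<close>.\<close>

lemma ex_simulated_in_tree_rank:
  fixes T :: "'a list set"
  assumes \<gamma>: "Well_order \<gamma>" "ranked_by T \<gamma>"
  shows "simulated_in (tree_rank T) T (rank_ge (tree_rank T) T)"
proof -
  let ?W = "tree_rank T"
  let ?R = "rank_ge ?W T"
  have W: "Well_order ?W" by (rule tree_rank(1)[OF \<gamma>])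
  have "\<exists>s\<in>T. ?R a s" if a: "a \<in> Field ?W" for a
  proof (rule ccontr)
    assume no: "\<not> (\<exists>s\<in>T. ?R a s)"
    let ?B = "\<lambda>s. {b \<in> Field ?W. \<forall>t\<in>T. strict_prefix s t \<longrightarrow> \<not> ?R b t}"
    have below: "\<exists>b. (b, c) \<in> ?W - Id \<and> b \<in> ?B s" if c: "\<not> ?R c s" for c s
    proof -
      obtain b where "(b, c) \<in> ?W - Id" "\<not> (\<exists>t\<in>T. strict_prefix s t \<and> ?R b t)"
        using c rank_ge.intros[where \<alpha> = ?W and T = T and a = c and s = s] by blast
      then show ?thesis by (intro exI[of _ b]) (auto simp: Field_def)
    qed
    have "\<exists>m\<in>?B s. \<forall>b\<in>?B s. (m, b) \<in> ?W" for s
      by (rule Well_order_ex_least[OF W]) (use a no in blast)+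
    then have "\<forall>s. \<exists>m. m \<in> ?B s \<and> (\<forall>b\<in>?B s. (m, b) \<in> ?W)" by blast
    then obtain m where *: "\<forall>s. m s \<in> ?B s \<and> (\<forall>b\<in>?B s. (m s, b) \<in> ?W)"
      unfolding choice_iff by (elim exE)
    have m: "\<And>s. m s \<in> ?B s" "\<And>s b. b \<in> ?B s \<Longrightarrow> (m s, b) \<in> ?W"
      using * by blast+
    have "ranked_by T (initseg ?W a)"
    proof (rule ranked_byI[where f = m])
      have less: "(m s, c) \<in> ?W - Id" if "\<not> ?R c s" for c s
        using below[OF that] m(2) Well_order_le_strict_trans[OF W] by blast
      have *: "m s \<in> underS ?W a" if "s \<in> T" for s
        using less[of a s] no that by (auto simp: underS_def)
      then show "m s \<in> Field (initseg ?W a)" if "s \<in> T" for s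
        using that unfolding Field_initseg[OF W] .
      fix s t assume st: "s \<in> T" "t \<in> T" "strict_prefix s t"
      then have "\<not> ?R (m s) t" using m(1)[of s] by blast
      then show "(m t, m s) \<in> initseg ?W a - Id" using less * st by blast
    qed
    then have "?W \<le>o initseg ?W a" by (rule tree_rank(3)[OF Well_order_initseg[OF W]])
    then show False using underS_Restr_ordLess[OF W] a not_ordLess_ordLeq by fastforce
  qed
  then show ?thesis
    unfolding simulated_in_def by (blast elim: rank_ge.cases)
qed

lemma simulated_in_ordLeq_trans:
  assumes "\<beta> \<le>o \<alpha>" "simulated_in \<alpha> T R"
  shows "\<exists>R. simulated_in \<beta> T R"
proof -
  obtain h where h: "\<And>a. a \<in> Field \<beta> \<Longrightarrow> h a \<in> Field \<alpha>"
    "\<And>a b. (a, b) \<in> \<beta> - Id \<Longrightarrow> (h a, h b) \<in> \<alpha> - Id"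
    using ordLeq_strict_mono[OF assms(1)] by metis
  show ?thesis
    by (rule exI[of _ "\<lambda>a. R (h a)"]) (use assms(2) h in \<open>unfold simulated_in_def, blast\<close>)
qed

text \<open>The ranks are chosen by recursion in a successor cardinal, whose regularity bounds the ranks
  of the proper extensions of a node.\<close>

lemma ex_ranked_by:
  fixes T :: "'a list set"
  assumes wf: "wf {(t, s). s \<in> T \<and> t \<in> T \<and> strict_prefix s t}"
  shows "\<exists>\<gamma> :: 'a list set rel. Well_order \<gamma> \<and> ranked_by T \<gamma>"
proof -
  let ?U = "|UNIV :: 'a list set|"
  let ?E = "cardSuc ?U"
  have C: "Card_order ?E" by (rule cardSuc_Card_order[OF card_of_Card_order])
  then have E: "Well_order ?E" by (rule card_order_on_well_order_on)
  have inf: "infinite (Field ?U)" by (simp add: Field_card_of infinite_UNIV_listI)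
  have infE: "infinite (Field ?E)" using cardSuc_finite[OF card_of_Card_order] inf by blast
  have bound: "\<exists>a\<in>Field ?E. \<forall>b\<in>K. (b, a) \<in> ?E - Id"
    if K: "K \<subseteq> Field ?E" "|K| \<le>o ?U" for K
  proof -
    have "|K| <o ?E" using K(2) cardSuc_greater[OF card_of_Card_order] by (rule ordLeq_ordLess_trans)
    then have "\<not> cofinal K ?E"
      using infinite_cardSuc_regularCard[OF inf card_of_Card_order] K(1) not_ordLess_ordIso
      unfolding regularCard_def by blast
    then obtain a where a: "a \<in> Field ?E" "\<And>b. b \<in> K \<Longrightarrow> (a, b) \<notin> ?E - Id"
      unfolding cofinal_def by blast
    \<comment> \<open>Failure of cofinality gives only a weak upper bound \<open>a\<close>; an
      infinite cardinal has no last element, so the bound can be made strict.\<close>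
    obtain c where c: "c \<in> Field ?E" "(a, c) \<in> ?E - Id"
      using infinite_Card_order_limit[OF C infE a(1)] by blast
    have "(b, c) \<in> ?E - Id" if "b \<in> K" for b
      using Well_order_linear[OF E, of b a] a K(1) that Well_order_le_strict_trans[OF E _ c(2)] by blast
    then show ?thesis using c(1) by blast
  qed
  \<comment> \<open>Any strict upper bound will do here: the minimisation is left to
    \<open>tree_rank\<close>.\<close>
  define F where "F f s = (SOME a. a \<in> Field ?E \<and>
    (\<forall>t\<in>T. strict_prefix s t \<longrightarrow> (f t, a) \<in> ?E - Id))" for f s
  define f where "f = wfrec {(t, s). s \<in> T \<and> t \<in> T \<and> strict_prefix s t} F"
  have f: "f s \<in> Field ?E \<and> (\<forall>t\<in>T. strict_prefix s t \<longrightarrow> (f t, f s) \<in> ?E - Id)" if "s \<in> T" for s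
    using wf that
  proof (induction s rule: wf_induct_rule)
    case (less s)
    have "f s = F (cut f {(t, s). s \<in> T \<and> t \<in> T \<and> strict_prefix s t} s) s"
      unfolding f_def by (rule wfrec[OF wf])
    also have "\<dots> = F f s"
      unfolding F_def using less.prems by (intro arg_cong[where f = Eps] ext) (auto simp: cut_apply)
    finally have eq: "f s = F f s" .
    let ?K = "f ` {t \<in> T. strict_prefix s t}"
    have "?K \<subseteq> Field ?E" using less by blast
    moreover have "|?K| \<le>o ?U"
      using ordLeq_transitive[OF card_of_image card_of_mono1[OF subset_UNIV]] .
    ultimately have "\<exists>a\<in>Field ?E. \<forall>b\<in>?K. (b, a) \<in> ?E - Id" by (rule bound)
    then obtain a where "a \<in> Field ?E" "\<forall>b\<in>?K. (b, a) \<in> ?E - Id" by (elim bexE)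
    then have "\<exists>a. a \<in> Field ?E \<and> (\<forall>t\<in>T. strict_prefix s t \<longrightarrow> (f t, a) \<in> ?E - Id)"
      by (intro exI[of _ a]) simp
    from someI_ex[OF this] show ?case unfolding eq F_def .
  qed
  have "ranked_by T ?E"
  proof (rule ranked_byI)
    show "f s \<in> Field ?E" if "s \<in> T" for s using f[OF that] ..
    show "(f t, f s) \<in> ?E - Id" if "s \<in> T" "t \<in> T" "strict_prefix s t" for s t
      using f[OF that(1)] that(2,3) by simp
  qed
  then show ?thesis using E by blast
qed

subsection \<open>The lower bound\<close>

lemma incomparable_sym: "incomparable r x y \<longleftrightarrow> incomparable r y x"
  by (auto simp: incomparable_def)

text \<open>By symmetry the pairs with \<open>i < j\<close> suffice, and \<open>sorted_wrt\<close>
  behaves well under filtering, mapping and appending.\<close>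

lemma antichain_seqs_iff:
  "s \<in> antichain_seqs r \<longleftrightarrow> s \<noteq> [] \<and> set s \<subseteq> Field r \<and> sorted_wrt (incomparable r) s"
proof -
  have "(\<forall>i<length s. \<forall>j<length s. i \<noteq> j \<longrightarrow> incomparable r (s ! i) (s ! j)) \<longleftrightarrow>
      (\<forall>i j. i < j \<longrightarrow> j < length s \<longrightarrow> incomparable r (s ! i) (s ! j))" (is "_ \<longleftrightarrow> ?R")
  proof (intro iffI allI impI)
    fix i j assume R: ?R and ij: "i < length s" "j < length s" "i \<noteq> j"
    show "incomparable r (s ! i) (s ! j)"
    proof (cases "i < j")
      case False
      then have "incomparable r (s ! j) (s ! i)" using R ij by simp
      then show ?thesis by (simp only: incomparable_sym)
    qed (use R ij in simp)
  qed simp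
  then show ?thesis
    unfolding antichain_seqs_def sorted_wrt_iff_nth_less by simp
qed

lemma antichain_seqs_append:
  "s @ t \<in> antichain_seqs r \<longleftrightarrow> (s \<noteq> [] \<or> t \<noteq> []) \<and> set s \<subseteq> Field r \<and> set t \<subseteq> Field r \<and>
     sorted_wrt (incomparable r) s \<and> sorted_wrt (incomparable r) t \<and>
     (\<forall>x\<in>set s. \<forall>y\<in>set t. incomparable r x y)"
  unfolding antichain_seqs_iff by (auto simp: sorted_wrt_append)

lemma Partial_order_refl: "Partial_order r \<Longrightarrow> x \<in> Field r \<Longrightarrow> (x, x) \<in> r"
  by (simp add: partial_order_on_def preorder_on_def refl_on_def)

lemma distinct_if_sorted_wrt_incomparable:
  assumes "\<And>x. x \<in> set s \<Longrightarrow> (x, x) \<in> r" "sorted_wrt (incomparable r) s"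
  shows "distinct s"
  using assms by (induction s) (auto simp: incomparable_def)

text \<open>The entries along an infinite branch would form an antichain \<open>A\<close>. It is
  finite, yet the node numbered \<open>i\<close> has at least \<open>i\<close> distinct entries in
  it.\<close>

lemma ranked_width:
  fixes P :: "'a rel"
  assumes P: "Partial_order P" and fin: "no_infinite_antichains P"
  shows "Well_order (width P)" "ranked_by (antichain_seqs P) (width P)"
proof -
  let ?T = "antichain_seqs P"
  have "wf {(t, s). s \<in> ?T \<and> t \<in> ?T \<and> strict_prefix s t}"
    unfolding wf_iff_no_infinite_down_chain
  proof
    assume "\<exists>f. \<forall>i. (f (Suc i), f i) \<in> {(t, s). s \<in> ?T \<and> t \<in> ?T \<and> strict_prefix s t}"
    then obtain f where f: "\<And>i. f i \<in> ?T" "\<And>i. strict_prefix (f i) (f (Suc i))" by auto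
    have mono: "prefix (f i) (f j)" if "i \<le> j" for i j
      using that
    proof (induction j rule: dec_induct)
      case (step n)
      then show ?case using f(2)[of n] by (auto simp: strict_prefix_def intro: prefix_order.trans)
    qed simp
    define A where "A = (\<Union>i. set (f i))"
    have dist: "distinct (f i)" for i
      using f(1)[of i] Partial_order_refl[OF P]
      by (intro distinct_if_sorted_wrt_incomparable[of _ P]) (auto simp: antichain_seqs_iff)
    have "antichain P A"
      unfolding antichain_def
    proof (intro conjI ballI impI)
      show "A \<subseteq> Field P" using f(1) by (auto simp: A_def antichain_seqs_iff)
      fix x y assume "x \<in> A" "y \<in> A" "x \<noteq> y"
      then obtain i j where "x \<in> set (f i)" "y \<in> set (f j)" by (auto simp: A_def)
      then have "x \<in> set (f (max i j))" "y \<in> set (f (max i j))"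
        using mono[of i "max i j"] mono[of j "max i j"] set_mono_prefix by fastforce+
      then obtain k l where "k < length (f (max i j))" "l < length (f (max i j))"
        "x = f (max i j) ! k" "y = f (max i j) ! l" by (metis in_set_conv_nth)
      then show "incomparable P x y"
        using f(1)[of "max i j"] \<open>x \<noteq> y\<close> unfolding antichain_seqs_def by auto
    qed
    then have "finite A" using fin unfolding no_infinite_antichains_def by blast
    have "i \<le> length (f i)" for i
    proof (induction i)
      case (Suc i)
      then show ?case using prefix_length_less[OF f(2)[of i]] by simp
    qed simp
    moreover have "length (f i) \<le> card A" for i
      using distinct_card[OF dist[of i]] card_mono[OF \<open>finite A\<close>, of "set (f i)"]
      by (auto simp: A_def)
    ultimately have "Suc (card A) \<le> card A" using order_trans by blast
    then show False by simp
  qed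
  then obtain \<gamma> :: "'a list set rel" where \<gamma>: "Well_order \<gamma>" "ranked_by ?T \<gamma>"
    using ex_ranked_by by blast
  show "Well_order (width P)" "ranked_by ?T (width P)"
    unfolding width_def by (rule tree_rank[OF \<gamma>])+
qed

section \<open>Incomparability in products and after removing lower cones\<close>

lemma Field_prod_rel:
  assumes "\<And>x. x \<in> Field r \<Longrightarrow> (x, x) \<in> r" "\<And>y. y \<in> Field s \<Longrightarrow> (y, y) \<in> s"
  shows "Field (r \<times>\<^sub>p s) = Field r \<times> Field s"
proof -
  have "(x, y) \<in> Field (r \<times>\<^sub>p s)" if "x \<in> Field r" "y \<in> Field s" for x y
    using assms(1)[OF that(1)] assms(2)[OF that(2)]
    by (intro FieldI1[of _ "(x, y)"]) (simp add: prod_rel_def)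
  moreover have "x \<in> Field r \<and> y \<in> Field s" if xy: "(x, y) \<in> Field (r \<times>\<^sub>p s)" for x y
  proof -
    obtain q where "((x, y), q) \<in> r \<times>\<^sub>p s \<or> (q, (x, y)) \<in> r \<times>\<^sub>p s"
      using xy unfolding Field_def by blast
    then show ?thesis by (cases q) (auto simp: prod_rel_def FieldI1 FieldI2)
  qed
  ultimately show ?thesis by auto
qed

lemma Field_prod_natLeq_on:
  assumes "Partial_order P"
  shows "Field (P \<times>\<^sub>p natLeq_on m) = Field P \<times> {..<m}"
  by (subst Field_prod_rel) (auto simp: Partial_order_refl[OF assms] Field_natLeq_on)

lemma incomparable_prod_natLeq_on:
  "incomparable (P \<times>\<^sub>p natLeq_on m) (x, i) (y, j) \<longleftrightarrow>
     \<not> (i < m \<and> j < m \<and> i \<le> j \<and> (x, y) \<in> P) \<and> \<not> (i < m \<and> j < m \<and> j \<le> i \<and> (y, x) \<in> P)"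
  by (auto simp: incomparable_def prod_rel_def)

definition minus_below :: "'a rel \<Rightarrow> 'a set \<Rightarrow> 'a rel" where
  "minus_below r X = Restr r (Field r - (\<Union>x\<in>X. under r x))"

lemma Field_minus_below:
  assumes "Partial_order r"
  shows "Field (minus_below r X) = {y \<in> Field r. \<forall>x\<in>X. (y, x) \<notin> r}"
  using Partial_order_refl[OF assms] unfolding minus_below_def
  by (auto simp: Field_def under_def)

lemma antichain_seqs_minus_below:
  assumes "Partial_order r"
  shows "s \<in> antichain_seqs (minus_below r X) \<longleftrightarrow>
    s \<in> antichain_seqs r \<and> (\<forall>y\<in>set s. \<forall>x\<in>X. (y, x) \<notin> r)"
proof -
  have "sorted_wrt (incomparable (minus_below r X)) s \<longleftrightarrow> sorted_wrt (incomparable r) s"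
    if "set s \<subseteq> Field (minus_below r X)"
  proof -
    have "incomparable (minus_below r X) x y \<longleftrightarrow> incomparable r x y" if "x \<in> set s" "y \<in> set s" for x y
      using \<open>set s \<subseteq> _\<close> that unfolding Field_minus_below[OF assms]
      by (auto simp: incomparable_def minus_below_def under_def subset_iff)
    then show ?thesis using sorted_wrt_mono_rel by metis
  qed
  then show ?thesis unfolding antichain_seqs_iff Field_minus_below[OF assms] by blast
qed

text \<open>The rows of \<open>P \<times> m\<close> are played from the top one downwards: the elements \<open>X\<close> played in
  higher rows only exclude the elements below \<open>X\<close> from the current row, and by transferability
  the width of what remains is still \<open>width P\<close>.\<close>

lemma width_prod_lower:
  fixes P :: "'a rel"
  assumes P: "Partial_order P" "no_infinite_antichains P" and tr: "transferable P"
    and \<gamma>: "Well_order \<gamma>" "ranked_by (antichain_seqs (P \<times>\<^sub>p natLeq_on m)) \<gamma>"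
  shows "width P \<cdot>\<^sub>o natLeq_on m \<le>o \<gamma>"
proof -
  let ?T = "antichain_seqs (P \<times>\<^sub>p natLeq_on m)"
  let ?W = "width P"
  note W = ranked_width[OF P]
  have "\<exists>R. simulated_in ?W (antichain_seqs (minus_below P X)) R" if X: "finite X" "X \<subseteq> Field P" for X
  proof -
    have "ranked_by (antichain_seqs (minus_below P X)) ?W"
      by (rule ranked_by_subset[OF W(2)]) (auto simp: antichain_seqs_minus_below[OF P(1)])
    then have sim: "\<exists>R. simulated_in (width (minus_below P X)) (antichain_seqs (minus_below P X)) R"
      using ex_simulated_in_tree_rank[OF W(1)] unfolding width_def[of "minus_below P X"] by blast
    have "width (minus_below P X) =o ?W"
      using tr X unfolding transferable_def minus_below_def by simp
    then have "?W \<le>o width (minus_below P X)" using ordIso_iff_ordLeq by blast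
    then show ?thesis using sim simulated_in_ordLeq_trans by blast
  qed
  then have "\<forall>X. \<exists>R. finite X \<and> X \<subseteq> Field P \<longrightarrow> simulated_in ?W (antichain_seqs (minus_below P X)) R"
    by blast
  then obtain R where "\<forall>X. finite X \<and> X \<subseteq> Field P \<longrightarrow>
      simulated_in ?W (antichain_seqs (minus_below P X)) (R X)"
    unfolding choice_iff by (elim exE)
  then have R: "simulated_in ?W (antichain_seqs (minus_below P X)) (R X)"
    if "finite X" "X \<subseteq> Field P" for X using that by simp
  define row where "row i = map (\<lambda>x :: 'a. (x, i :: nat))" for i
  \<comment> \<open>The row is the more significant coordinate of \<open>(a, i)\<close>: within row
    \<open>i\<close> the rank \<open>a\<close> goes down, and on entering a lower row it may start
    anew at any value.\<close>
  define S where "S = (\<lambda>(a, i) s. \<exists>s' u. s = s' @ row i u \<and> s \<in> ?T \<and> (\<forall>p\<in>set s'. i < snd p) \<and>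
    u \<in> antichain_seqs (minus_below P (fst ` set s')) \<and> R (fst ` set s') a u)"
  have FT: "Field (P \<times>\<^sub>p natLeq_on m) = Field P \<times> {..<m}" by (rule Field_prod_natLeq_on[OF P(1)])
  have fst_sub: "fst ` set s \<subseteq> Field P" if "set s \<subseteq> Field (P \<times>\<^sub>p natLeq_on m)" for s
    using that unfolding FT by auto
  \<comment> \<open>Entries of \<open>s'\<close> lie in higher rows, so none is below a new entry; a
    new entry is not below any of them because it comes from \<open>minus_below\<close>.\<close>
  have extend: "s' @ row i u \<in> ?T"
    if s': "set s' \<subseteq> Field (P \<times>\<^sub>p natLeq_on m)" "sorted_wrt (incomparable (P \<times>\<^sub>p natLeq_on m)) s'"
      "\<forall>p\<in>set s'. i < snd p" and i: "i < m" and u: "u \<in> antichain_seqs (minus_below P (fst ` set s'))"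
    for s' i u
  proof -
    have u': "u \<noteq> []" "set u \<subseteq> Field P" "sorted_wrt (incomparable P) u"
      "\<And>y p. y \<in> set u \<Longrightarrow> p \<in> set s' \<Longrightarrow> (y, fst p) \<notin> P"
      using u[unfolded antichain_seqs_minus_below[OF P(1)]] unfolding antichain_seqs_iff by auto
    have "sorted_wrt (incomparable (P \<times>\<^sub>p natLeq_on m)) (row i u)"
      unfolding row_def sorted_wrt_map
      by (rule sorted_wrt_mono_rel[OF _ u'(3)])
        (simp add: incomparable_prod_natLeq_on, simp add: incomparable_def)
    moreover have "incomparable (P \<times>\<^sub>p natLeq_on m) p q" if mem: "p \<in> set s'" "q \<in> set (row i u)" for p q
    proof -
      obtain x j where p: "p = (x, j)" by (cases p)
      obtain y where q: "q = (y, i)" "y \<in> set u" using mem by (auto simp: row_def)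
      show ?thesis using u'(4)[OF q(2) mem(1)] s'(3) mem(1) unfolding p q incomparable_prod_natLeq_on by auto
    qed
    moreover have "set (row i u) \<subseteq> Field (P \<times>\<^sub>p natLeq_on m)"
      using u'(2) i unfolding FT by (auto simp: row_def)
    ultimately show ?thesis using s' u'(1) unfolding antichain_seqs_append by (auto simp: row_def)
  qed
  \<comment> \<open>Enters row \<open>i\<close> after any sequence in higher rows; the empty one
    provides the initial nodes.\<close>
  have start: "\<exists>t\<in>?T. strict_prefix s t \<and> S (a, i) t"
    if s: "set s \<subseteq> Field (P \<times>\<^sub>p natLeq_on m)" "sorted_wrt (incomparable (P \<times>\<^sub>p natLeq_on m)) s"
      "\<forall>p\<in>set s. i < snd p" and i: "i < m" and a: "a \<in> Field ?W" for s a i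
  proof -
    obtain u where u: "u \<in> antichain_seqs (minus_below P (fst ` set s))" "R (fst ` set s) a u"
      using R[of "fst ` set s"] fst_sub[OF s(1)] a unfolding simulated_in_def by blast
    have "s @ row i u \<in> ?T" by (rule extend[OF s i u(1)])
    moreover from this have "S (a, i) (s @ row i u)" unfolding S_def using u s by auto
    moreover have "strict_prefix s (s @ row i u)"
      using u(1) by (auto simp: antichain_seqs_iff row_def strict_prefix_def)
    ultimately show ?thesis by blast
  qed
  have WM: "Well_order (natLeq_on m)" by (rule natLeq_on_Well_order)
  have "simulated_in (?W \<cdot>\<^sub>o natLeq_on m) ?T S"
    unfolding simulated_in_def Field_ord_prod[OF W(1) WM]
  proof (intro conjI ballI allI impI)
    fix p assume "p \<in> Field ?W \<times> Field (natLeq_on m)"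
    then obtain a i where p: "p = (a, i)" "a \<in> Field ?W" "i < m" by (auto simp: Field_natLeq_on)
    show "\<exists>s\<in>?T. S p s" using start[of "[]" i a] p by auto
  next
    fix p s q assume "S p s" and qp: "(q, p) \<in> ?W \<cdot>\<^sub>o natLeq_on m - Id"
    obtain a i b j where pq: "p = (a, i)" "q = (b, j)" by (cases p, cases q)
    obtain s' u where s: "s = s' @ row i u" "s \<in> ?T" "\<forall>p\<in>set s'. i < snd p"
      "u \<in> antichain_seqs (minus_below P (fst ` set s'))" "R (fst ` set s') a u"
      using \<open>S p s\<close> unfolding S_def pq by auto
    have s_T: "set s \<subseteq> Field (P \<times>\<^sub>p natLeq_on m)" "sorted_wrt (incomparable (P \<times>\<^sub>p natLeq_on m)) s"
      using s(2) unfolding antichain_seqs_iff by auto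
    have *: "b \<in> Field ?W" "i < m" "j < m" "j < i \<or> j = i \<and> (b, a) \<in> ?W - Id"
      using qp unfolding pq ord_prod_strict_iff by (auto simp: Field_natLeq_on)
    from *(4) show "\<exists>t\<in>?T. strict_prefix s t \<and> S q t"
    proof (elim disjE conjE)
      assume "j < i"
      then have "\<forall>p\<in>set s. j < snd p" using s(1,3) by (auto simp: row_def)
      from start[OF s_T this *(3) *(1)] show ?thesis unfolding pq .
    next
      assume ba: "j = i" "(b, a) \<in> ?W - Id"
      have s': "set s' \<subseteq> Field (P \<times>\<^sub>p natLeq_on m)" "sorted_wrt (incomparable (P \<times>\<^sub>p natLeq_on m)) s'"
        using s_T unfolding s(1) by (auto simp: sorted_wrt_append)
      obtain v where v: "v \<in> antichain_seqs (minus_below P (fst ` set s'))" "strict_prefix u v"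
        "R (fst ` set s') b v"
        using R[of "fst ` set s'"] fst_sub[OF s'(1)] s(5) ba(2) unfolding simulated_in_def by blast
      have T: "s' @ row i v \<in> ?T" by (rule extend[OF s' s(3) *(2) v(1)])
      moreover have "S q (s' @ row i v)" unfolding S_def pq using ba T s(3) v by auto
      moreover have "strict_prefix s (s' @ row i v)"
        using v(2) unfolding s(1) row_def by (auto simp: strict_prefix_def prefix_def)
      ultimately show ?thesis by blast
    qed
  qed
  then show ?thesis by (rule simulated_in_ordLeq[OF Well_order_ord_prod[OF W(1) WM] \<gamma>])
qed

subsection \<open>The upper bound\<close>

text \<open>Adding the same coefficients on both sides leaves the deciding argument unchanged. This
  is the strict monotonicity that natural addition has in each summand.\<close>

lemma omega_pow_add_strict:
  assumes "(f, g) \<in> omega_pow E - Id" "h \<in> fin_supp E"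
  shows "(\<lambda>x. f x + h x, \<lambda>x. g x + h x) \<in> omega_pow E - Id"
proof -
  have "f \<in> fin_supp E" "g \<in> fin_supp E" using assms(1) unfolding omega_pow_strict_iff by auto
  then show ?thesis
    using assms fin_supp_add[of _ E h] unfolding omega_pow_strict_iff by simp
qed

lemma omega_pow_add_mono:
  assumes E: "Well_order E" and "(f, g) \<in> omega_pow E" "(f', g') \<in> omega_pow E"
  shows "(\<lambda>x. f x + f' x, \<lambda>x. g x + g' x) \<in> omega_pow E"
proof -
  note w = Well_order_omega_pow[OF E]
  have supp: "f \<in> fin_supp E" "g \<in> fin_supp E" "f' \<in> fin_supp E" "g' \<in> fin_supp E"
    using assms(2,3) by (auto simp: omega_pow_def)
  have add: "(\<lambda>x. f x + h x, \<lambda>x. g x + h x) \<in> omega_pow E"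
    if "(f, g) \<in> omega_pow E" "f \<in> fin_supp E" "h \<in> fin_supp E" for f g h
  proof (cases "f = g")
    case True
    then show ?thesis
      using Well_order_refl[OF w] fin_supp_add[OF that(2,3)] by (simp add: Field_omega_pow)
  next
    case False
    then show ?thesis using omega_pow_add_strict[of f g E h] that by blast
  qed
  have "(\<lambda>x. f x + f' x, \<lambda>x. g x + f' x) \<in> omega_pow E" by (rule add[OF assms(2) supp(1,3)])
  moreover have "(\<lambda>x. g x + f' x, \<lambda>x. g x + g' x) \<in> omega_pow E"
    using add[OF assms(3) supp(3,2)] by (simp add: add.commute)
  ultimately show ?thesis by (rule Well_order_trans[OF w])
qed

lemma omega_pow_sum_mono:
  assumes E: "Well_order E" and "finite I" "\<forall>i\<in>I. (f i, g i) \<in> omega_pow E"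
  shows "(\<lambda>x. \<Sum>i\<in>I. f i x, \<lambda>x. \<Sum>i\<in>I. g i x) \<in> omega_pow E"
  using assms(2,3)
proof (induction I rule: finite_induct)
  case empty
  then show ?case using zero_in_fin_supp by (simp add: omega_pow_def)
next
  case (insert i I)
  then show ?case using omega_pow_add_mono[OF E, of "f i" "g i"] by simp
qed

lemma omega_pow_sum_strict:
  assumes E: "Well_order E" and I: "finite I" "\<forall>i\<in>I. (f i, g i) \<in> omega_pow E"
    and j: "j \<in> I" "(f j, g j) \<in> omega_pow E - Id"
  shows "(\<lambda>x. \<Sum>i\<in>I. f i x, \<lambda>x. \<Sum>i\<in>I. g i x) \<in> omega_pow E - Id"
proof -
  note w = Well_order_omega_pow[OF E]
  let ?J = "I - {j}"
  have le: "(\<lambda>x. \<Sum>i\<in>?J. f i x, \<lambda>x. \<Sum>i\<in>?J. g i x) \<in> omega_pow E"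
    by (rule omega_pow_sum_mono[OF E]) (use I in auto)
  then have supp: "(\<lambda>x. \<Sum>i\<in>?J. f i x) \<in> fin_supp E" by (auto simp: omega_pow_def)
  have "g j \<in> fin_supp E" using j(2) by (auto simp: omega_pow_def)
  then have refl: "(g j, g j) \<in> omega_pow E" using Well_order_refl[OF w] by (simp add: Field_omega_pow)
  have "(\<lambda>x. f j x + (\<Sum>i\<in>?J. f i x), \<lambda>x. g j x + (\<Sum>i\<in>?J. g i x)) \<in> omega_pow E - Id"
    by (rule Well_order_strict_le_trans[OF w omega_pow_add_strict[OF j(2) supp]
          omega_pow_add_mono[OF E refl le]])
  then show ?thesis using I(1) j(1) by (simp add: sum.remove[of I j])
qed

text \<open>Common core of both upper bounds; a slice is a row in one and a plane in the other.
  Extending a sequence shortens no slice and properly extends one that contains the first new entry,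
  so the natural sum of the slice values drops strictly.\<close>

lemma slice_sum_strict:
  fixes f :: "'i \<Rightarrow> 'a \<Rightarrow> 'b" and K :: "'i \<Rightarrow> 'a \<Rightarrow> bool"
  defines "\<sigma> \<equiv> \<lambda>i s. map (f i) (filter (K i) s)"
  assumes E: "Well_order E" and I: "finite I" and st: "strict_prefix s t"
    and cover: "\<And>y. y \<in> set (drop (length s) t) \<Longrightarrow> \<exists>i\<in>I. K i y"
    and V: "\<And>i. i \<in> I \<Longrightarrow> \<sigma> i s \<in> V" "\<And>i. i \<in> I \<Longrightarrow> \<sigma> i t \<in> V"
    and h: "\<And>v. v \<in> V \<Longrightarrow> h v \<in> fin_supp E"
      "\<And>v w. v \<in> V \<Longrightarrow> w \<in> V \<Longrightarrow> strict_prefix v w \<Longrightarrow> (h w, h v) \<in> omega_pow E - Id"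
  shows "(\<lambda>x. \<Sum>i\<in>I. h (\<sigma> i t) x, \<lambda>x. \<Sum>i\<in>I. h (\<sigma> i s) x) \<in> omega_pow E - Id"
proof -
  obtain u where u: "t = s @ u" "u \<noteq> []"
    using st by (auto simp: strict_prefix_def prefix_def)
  have app: "\<sigma> i t = \<sigma> i s @ \<sigma> i u" for i by (simp add: \<sigma>_def u)
  have le: "\<forall>i\<in>I. (h (\<sigma> i t), h (\<sigma> i s)) \<in> omega_pow E"
  proof
    fix i assume i: "i \<in> I"
    show "(h (\<sigma> i t), h (\<sigma> i s)) \<in> omega_pow E"
    proof (cases "\<sigma> i u = []")
      case True
      then show ?thesis using h(1)[OF V(1)[OF i]] by (simp add: app omega_pow_def)
    next
      case False
      then have "strict_prefix (\<sigma> i s) (\<sigma> i t)" by (simp add: app strict_prefix_def)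
      then show ?thesis using h(2)[OF V[OF i]] by blast
    qed
  qed
  obtain j where j: "j \<in> I" "K j (hd u)" using cover[of "hd u"] u by auto
  then have "\<sigma> j u \<noteq> []" using u(2) by (cases u) (auto simp: \<sigma>_def)
  then have "strict_prefix (\<sigma> j s) (\<sigma> j t)" by (simp add: app strict_prefix_def)
  then show ?thesis using omega_pow_sum_strict[OF E I le j(1)] h(2)[OF V[OF j(1)]] by blast
qed

lemma count_map_concat_replicate:
  "count (mset (map c (concat (map (replicate m) es)))) x = m * count (mset (map c es)) x"
proof (induction es)
  case (Cons e es)
  have "count (mset (map c (replicate m e))) x = (if c e = x then m else 0)"
    by (induction m) auto
  then show ?case using Cons by simp
qed simp

text \<open>A sequence in \<open>P \<times> m\<close> is ranked by the natural sum, over its rows, of the ranks in \<open>P\<close>,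
  where an empty row counts as \<open>width P\<close>; the natural sum is pointwise addition of the
  coefficients of Cantor normal forms.\<close>

lemma width_prod_upper:
  fixes P :: "'a rel" and es :: "'c rel list"
  assumes P: "Partial_order P" "no_infinite_antichains P"
    and es: "\<forall>e\<in>set es. Well_order e" "descending es"
    and le: "width P \<le>o ord_sum_list (map omega_pow es)"
  shows "\<exists>\<gamma> :: ('c set \<Rightarrow> nat) rel. Well_order \<gamma> \<and>
    ranked_by (antichain_seqs (P \<times>\<^sub>p natLeq_on m)) \<gamma> \<and>
    \<gamma> =o ord_sum_list (map omega_pow (concat (map (replicate m) es)))"
proof -
  define E where "E = cardSuc |UNIV :: 'c set|"
  have E: "Well_order E"
    using cardSuc_Card_order[OF card_of_Card_order] card_order_on_well_order_on unfolding E_def by blast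
  have es': "\<forall>e\<in>set es. e <o E" using es(1) ordLess_cardSuc_UNIV unfolding E_def by blast
  let ?\<Omega> = "omega_pow E"
  let ?ms = "concat (map (replicate m) es)"
  define top where "top = count (mset (map (exponent E) es))"
  define mtop where "mtop = count (mset (map (exponent E) ?ms))"
  have w: "Well_order ?\<Omega>" by (rule Well_order_omega_pow[OF E])
  have mtop: "mtop = (\<lambda>x. \<Sum>i<m. top x)"
    unfolding mtop_def top_def by (rule ext) (simp only: count_map_concat_replicate, simp)
  have top_supp: "top \<in> fin_supp E"
    unfolding top_def by (rule count_mset_in_fin_supp) (use es' exponent_in_Field in fastforce)
  have ms: "\<forall>e\<in>set ?ms. e <o E" "descending ?ms"
    using es' descending_concat_replicate[OF es(2,1)] by auto
  let ?T = "antichain_seqs P"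
  let ?TM = "antichain_seqs (P \<times>\<^sub>p natLeq_on m)"
  have "width P \<le>o initseg ?\<Omega> top"
    unfolding top_def by (rule ordLeq_ordIso_trans[OF le ord_sum_omega_pow_exponents[OF E es' es(2)]])
  then have "\<exists>\<phi>. (\<forall>a\<in>Field (width P). \<phi> a \<in> Field (initseg ?\<Omega> top)) \<and>
      (\<forall>a b. (a, b) \<in> width P - Id \<longrightarrow> (\<phi> a, \<phi> b) \<in> initseg ?\<Omega> top - Id)"
    by (rule ordLeq_strict_mono) blast
  then obtain \<phi> where "\<forall>a\<in>Field (width P). \<phi> a \<in> Field (initseg ?\<Omega> top)"
    "\<forall>a b. (a, b) \<in> width P - Id \<longrightarrow> (\<phi> a, \<phi> b) \<in> initseg ?\<Omega> top - Id"
    by (elim exE conjE)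
  note \<phi> = this[rule_format]
  obtain f where "\<forall>s\<in>?T. f s \<in> Field (width P)"
    "\<forall>s\<in>?T. \<forall>t\<in>?T. strict_prefix s t \<longrightarrow> (f t, f s) \<in> width P - Id"
    using ranked_width(2)[OF P] unfolding ranked_by_iff by (elim exE conjE)
  note f = this[rule_format]
  \<comment> \<open>With the strict bound \<open>top\<close> as default, already the first entry of
    a row lowers its value.\<close>
  define h where "h s = (if s = [] then top else \<phi> (f s))" for s
  have h_top: "(h s, top) \<in> ?\<Omega> - Id" if "s \<in> ?T" for s
  proof -
    have "s \<noteq> []" using that by (simp add: antichain_seqs_iff)
    then show ?thesis using \<phi>(1)[OF f(1)[OF that]] unfolding Field_initseg[OF w]
      by (auto simp: h_def underS_def)
  qed
  have h_supp: "h v \<in> fin_supp E" if "v \<in> insert [] ?T" for v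
    using that h_top[of v] top_supp by (auto simp: h_def omega_pow_def)
  have h_less: "(h t, h s) \<in> ?\<Omega> - Id"
    if "s \<in> insert [] ?T" "t \<in> insert [] ?T" "strict_prefix s t" for s t
  proof -
    have t: "t \<in> ?T" "t \<noteq> []" using that by auto
    show ?thesis
    proof (cases "s = []")
      case True
      then show ?thesis using h_top[OF t(1)] by (simp add: h_def)
    next
      case False
      then have "s \<in> ?T" using that by blast
      then show ?thesis using \<phi>(2)[OF f(2)[OF _ t(1) that(3)]] False t(2) by (simp add: h_def)
    qed
  qed
  define row where "row i s = map fst (filter (\<lambda>p. snd p = i) s)" for i :: nat and s :: "('a \<times> nat) list"
  have row: "row i s \<in> insert [] ?T" if "s \<in> insert [] ?TM" "i < m" for i s
  proof -
    have s: "set s \<subseteq> Field P \<times> {..<m}" "sorted_wrt (incomparable (P \<times>\<^sub>p natLeq_on m)) s"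
      using that(1) by (auto simp: antichain_seqs_iff Field_prod_natLeq_on[OF P(1)])
    have "sorted_wrt (incomparable P) (row i s)"
      unfolding row_def sorted_wrt_map
    proof (rule sorted_wrt_mono_rel[OF _ sorted_wrt_filter[OF s(2)]])
      fix p q assume "p \<in> set (filter (\<lambda>p. snd p = i) s)" "q \<in> set (filter (\<lambda>p. snd p = i) s)"
        "incomparable (P \<times>\<^sub>p natLeq_on m) p q"
      then show "incomparable P (fst p) (fst q)"
        using that(2) by (simp add: incomparable_def prod_rel_def split_beta)
    qed
    moreover have "set (row i s) \<subseteq> Field P" using s(1) by (auto simp: row_def)
    ultimately show ?thesis by (auto simp: antichain_seqs_iff)
  qed
  have less: "(\<lambda>x. \<Sum>i<m. h (row i t) x, \<lambda>x. \<Sum>i<m. h (row i s) x) \<in> ?\<Omega> - Id"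
    if st: "s \<in> insert [] ?TM" "t \<in> ?TM" "strict_prefix s t" for s t
    unfolding row_def
  proof (rule slice_sum_strict[where V = "insert [] ?T" and h = h, OF E _ st(3)])
    fix y assume "y \<in> set (drop (length s) t)"
    then have "y \<in> set t" by (rule in_set_dropD)
    then have "snd y < m" using st(2) by (auto simp: antichain_seqs_iff Field_prod_natLeq_on[OF P(1)])
    then show "\<exists>i\<in>{..<m}. snd y = i" by simp
  next
    fix i assume "i \<in> {..<m}"
    then show "map fst (filter (\<lambda>p. snd p = i) s) \<in> insert [] ?T"
      "map fst (filter (\<lambda>p. snd p = i) t) \<in> insert [] ?T"
      using row[of s i] row[of t i] st unfolding row_def by blast+
  qed (use h_supp h_less in auto)
  \<comment> \<open>The empty sequence is no node, but its value is \<open>mtop\<close>; every node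
    extends it and so stays strictly below.\<close>
  have into: "(\<lambda>x. \<Sum>i<m. h (row i s) x, mtop) \<in> ?\<Omega> - Id" if "s \<in> ?TM" for s
  proof -
    have "strict_prefix [] s" using that by (auto simp: antichain_seqs_iff strict_prefix_def)
    from less[OF _ that this] show ?thesis by (simp add: mtop row_def h_def)
  qed
  have "ranked_by ?TM (initseg ?\<Omega> mtop)"
  proof (rule ranked_byI[where f = "\<lambda>s x. \<Sum>i<m. h (row i s) x"])
    show "(\<lambda>x. \<Sum>i<m. h (row i s) x) \<in> Field (initseg ?\<Omega> mtop)" if "s \<in> ?TM" for s
      using into[OF that] unfolding Field_initseg[OF w] by (auto simp: underS_def)
    fix s t assume st: "s \<in> ?TM" "t \<in> ?TM" "strict_prefix s t"
    then show "(\<lambda>x. \<Sum>i<m. h (row i t) x, \<lambda>x. \<Sum>i<m. h (row i s) x) \<in> initseg ?\<Omega> mtop - Id"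
      using into[OF st(1)] into[OF st(2)] less[of s t] by (auto simp: underS_def)
  qed
  moreover have "initseg ?\<Omega> mtop =o ord_sum_list (map omega_pow ?ms)"
    unfolding mtop_def by (rule ordIso_symmetric[OF ord_sum_omega_pow_exponents[OF E ms]])
  ultimately show ?thesis using Well_order_initseg[OF w] by blast
qed

subsection \<open>The product of three copies of omega\<close>

lemma incomparable_nat_pairs:
  "incomparable (natLeq \<times>\<^sub>p natLeq) p q \<longleftrightarrow>
     \<not> (fst p \<le> fst q \<and> snd p \<le> snd q) \<and> \<not> (fst q \<le> fst p \<and> snd q \<le> snd p)"
  by (cases p, cases q) (simp add: incomparable_def prod_rel_def natLeq_def)

lemma incomparable_nat_triples:
  "incomparable (natLeq \<times>\<^sub>p natLeq \<times>\<^sub>p natLeq) (a, b, c) (a', b', c') \<longleftrightarrow>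
     \<not> (a \<le> a' \<and> b \<le> b' \<and> c \<le> c') \<and> \<not> (a' \<le> a \<and> b' \<le> b \<and> c' \<le> c)"
  by (simp add: incomparable_def prod_rel_def natLeq_def)

lemma length_le_if_sorted_wrt_neq:
  fixes f :: "'a \<Rightarrow> nat"
  assumes "sorted_wrt (\<lambda>p q. f p \<noteq> f q) s" "\<forall>p\<in>set s. f p < n"
  shows "length s \<le> n"
proof -
  have "distinct (map f s)" using assms(1) by (induction s) auto
  then have "length s = card (f ` set s)" using distinct_card[of "map f s"] by simp
  also have "\<dots> \<le> card {..<n}" using assms(2) by (intro card_mono) auto
  finally show ?thesis by simp
qed

text \<open>A pair incomparable to \<open>p\<close> has a smaller first or a smaller second
  coordinate than \<open>p\<close>, and the members of an antichain differ in each coordinate. So at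
  most \<open>fst p\<close> and \<open>snd p\<close> others are possible of either kind.\<close>

lemma length_antichain_nat_pairs:
  assumes "sorted_wrt (incomparable (natLeq \<times>\<^sub>p natLeq)) (p # s)"
  shows "length (p # s) \<le> Suc (fst p + snd p)"
proof -
  let ?I = "incomparable (natLeq \<times>\<^sub>p natLeq)"
  let ?a = "filter (\<lambda>q. fst q < fst p) s" and ?b = "filter (\<lambda>q. \<not> fst q < fst p) s"
  have s: "sorted_wrt ?I s" "\<forall>q\<in>set s. ?I p q" using assms by auto
  have "length ?a \<le> fst p"
    by (rule length_le_if_sorted_wrt_neq[of fst])
      (auto intro!: sorted_wrt_mono_rel[OF _ sorted_wrt_filter[OF s(1)]] simp: incomparable_nat_pairs)
  moreover have "length ?b \<le> snd p"
    by (rule length_le_if_sorted_wrt_neq[of snd])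
      (use s(2) in \<open>auto intro!: sorted_wrt_mono_rel[OF _ sorted_wrt_filter[OF s(1)]]
        simp: incomparable_nat_pairs\<close>)
  moreover have "length s = length ?a + length ?b" by (rule sum_length_filter_compl[symmetric])
  ultimately show ?thesis by simp
qed

lemma natLeq_on_2_fin_supp: "f \<in> fin_supp (natLeq_on 2) \<longleftrightarrow> (\<forall>x\<ge>2. f x = 0)"
proof -
  have "(f x \<noteq> 0 \<longrightarrow> x < 2) \<longleftrightarrow> (2 \<le> x \<longrightarrow> f x = 0)" for x by linarith
  then have "{x. f x \<noteq> 0} \<subseteq> {x. x < 2} \<longleftrightarrow> (\<forall>x\<ge>2. f x = 0)"
    by (simp only: subset_iff mem_Collect_eq)
  moreover have "finite {x. f x \<noteq> 0}" if "{x. f x \<noteq> 0} \<subseteq> {x. x < (2 :: nat)}"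
    using that by (rule finite_subset) simp
  ultimately show ?thesis unfolding fin_supp_def Field_natLeq_on by blast
qed

text \<open>In this copy of the square of omega, \<open>f 1\<close> is the coefficient of omega and
  \<open>f 0\<close> the finite remainder.\<close>

lemma omega_pow_2_strict_iff:
  "(f, g) \<in> omega_pow (natLeq_on 2) - Id \<longleftrightarrow>
     (\<forall>x\<ge>2. f x = 0) \<and> (\<forall>x\<ge>2. g x = 0) \<and> (f 1 < g 1 \<or> f 1 = g 1 \<and> f 0 < g 0)"
proof -
  have "(\<exists>x\<in>Field (natLeq_on 2). f x < g x \<and> (\<forall>y. (x, y) \<in> natLeq_on 2 \<and> y \<noteq> x \<longrightarrow> f y = g y))
    \<longleftrightarrow> f 1 < g 1 \<or> f 1 = g 1 \<and> f 0 < g 0"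
    unfolding Field_natLeq_on by (auto simp: less_2_cases_iff)
  then show ?thesis unfolding omega_pow_strict_iff natLeq_on_2_fin_supp by simp
qed

text \<open>Numbering the coordinates lets the planes of all three directions be indexed by pairs
  \<open>(k, v)\<close>.\<close>

definition coord :: "nat \<Rightarrow> nat \<times> nat \<times> nat \<Rightarrow> nat" where
  "coord k p = (if k = 0 then fst p else if k = 1 then fst (snd p) else snd (snd p))"

definition drop_coord :: "nat \<Rightarrow> nat \<times> nat \<times> nat \<Rightarrow> nat \<times> nat" where
  "drop_coord k p = (if k = 0 then snd p else if k = 1 then (fst p, snd (snd p)) else (fst p, fst (snd p)))"

lemma incomparable_drop_coord:
  assumes "incomparable (natLeq \<times>\<^sub>p natLeq \<times>\<^sub>p natLeq) p q" "coord k p = coord k q"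
  shows "incomparable (natLeq \<times>\<^sub>p natLeq) (drop_coord k p) (drop_coord k q)"
proof -
  obtain a b c a' b' c' where "p = (a, b, c)" "q = (a', b', c')" by (metis prod.exhaust)
  then show ?thesis
    using assms by (auto simp: incomparable_nat_triples incomparable_nat_pairs coord_def drop_coord_def
        split: if_splits)
qed

lemma incomparable_coord_less:
  assumes "incomparable (natLeq \<times>\<^sub>p natLeq \<times>\<^sub>p natLeq) p q"
  shows "\<exists>k<3. coord k q < coord k p"
proof -
  obtain a b c a' b' c' where pq: "p = (a, b, c)" "q = (a', b', c')" by (metis prod.exhaust)
  then have "a' < a \<or> b' < b \<or> c' < c"
    using assms by (auto simp: incomparable_nat_triples not_le)
  then show ?thesis
    unfolding pq coord_def
    by (elim disjE) (rule exI[of _ 0] exI[of _ 1] exI[of _ 2], simp)+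
qed

text \<open>After a first element \<open>p\<close>, every further element lies in one of the finitely many planes
  \<open>coord k = v\<close> with \<open>v < coord k p\<close>.  A plane without an element counts as \<open>\<omega>\<close>; once it contains
  one, only finitely many more can follow in it.\<close>

lemma ranked_antichain_seqs_nat_cube:
  "ranked_by (antichain_seqs (natLeq \<times>\<^sub>p natLeq \<times>\<^sub>p natLeq)) (omega_pow (natLeq_on 2))"
proof -
  let ?E = "natLeq_on 2"
  let ?I3 = "incomparable (natLeq \<times>\<^sub>p natLeq \<times>\<^sub>p natLeq)"
  let ?I2 = "incomparable (natLeq \<times>\<^sub>p natLeq)"
  let ?T = "antichain_seqs (natLeq \<times>\<^sub>p natLeq \<times>\<^sub>p natLeq)"
  have E: "Well_order ?E" by (rule natLeq_on_Well_order)
  \<comment> \<open>Only the first entry matters, and it is shared by all extensions, so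
    \<open>s\<close> and \<open>t\<close> are summed over the same planes.\<close>
  define planes where "planes s = Sigma {..<3} (\<lambda>k. {..<coord k (hd s)})" for s
  \<comment> \<open>An empty plane has the value omega. After a first pair the bound of
    \<open>length_antichain_nat_pairs\<close> on the total length makes the value finite, and what
    is left of that bound is recorded; the bound also keeps the truncated subtraction strictly
    decreasing.\<close>
  define h :: "(nat \<times> nat) list \<Rightarrow> nat \<Rightarrow> nat" where
    "h v = (if v = [] then (\<lambda>x. if x = 1 then 1 else 0)
      else (\<lambda>x. if x = 0 then Suc (fst (hd v) + snd (hd v)) - length v else 0))" for v
  define \<sigma> where "\<sigma> i s = map (drop_coord (fst i)) (filter (\<lambda>p. coord (fst i) p = snd i) s)"
    for i :: "nat \<times> nat" and s
  have slice: "\<sigma> i s \<in> {v. sorted_wrt ?I2 v}" if "s \<in> ?T" for i s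
  proof -
    have "sorted_wrt ?I3 s" using that by (simp add: antichain_seqs_iff)
    then have *: "sorted_wrt ?I3 (filter (\<lambda>p. coord (fst i) p = snd i) s)" by (rule sorted_wrt_filter)
    show ?thesis
      unfolding \<sigma>_def mem_Collect_eq sorted_wrt_map
      by (rule sorted_wrt_mono_rel[OF _ *]) (simp add: incomparable_drop_coord)
  qed
  have supp: "h v \<in> fin_supp ?E" for v
    unfolding natLeq_on_2_fin_supp by (simp add: h_def)
  have h_less: "(h w, h v) \<in> omega_pow ?E - Id" if vw: "sorted_wrt ?I2 w" "strict_prefix v w" for v w
  proof -
    obtain u where u: "w = v @ u" "u \<noteq> []" using vw(2) by (auto simp: strict_prefix_def prefix_def)
    then have "w \<noteq> []" by simp
    then have len: "length w \<le> Suc (fst (hd w) + snd (hd w))"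
      using length_antichain_nat_pairs[of "hd w" "tl w"] vw(1) by simp
    show ?thesis
    proof (cases "v = []")
      case True
      then show ?thesis using \<open>w \<noteq> []\<close> unfolding omega_pow_2_strict_iff by (simp add: h_def)
    next
      case False
      then have "hd w = hd v" "length v < length w" using u by auto
      then show ?thesis using False \<open>w \<noteq> []\<close> len unfolding omega_pow_2_strict_iff
        by (simp add: h_def)
    qed
  qed
  show ?thesis
  proof (rule ranked_byI[where f = "\<lambda>s x. \<Sum>i\<in>planes s. h (\<sigma> i s) x"])
    have fin: "finite (planes s)" for s unfolding planes_def by (intro finite_SigmaI) auto
    show "(\<lambda>x. \<Sum>i\<in>planes s. h (\<sigma> i s) x) \<in> Field (omega_pow ?E)" for s
      using supp unfolding Field_omega_pow natLeq_on_2_fin_supp by simp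
    fix s t assume st: "s \<in> ?T" "t \<in> ?T" "strict_prefix s t"
    obtain u where u: "t = s @ u" using st(3) by (auto simp: strict_prefix_def prefix_def)
    have s_ne: "s \<noteq> []" using st(1) by (simp add: antichain_seqs_iff)
    have planes: "planes t = planes s" using s_ne by (simp add: planes_def u)
    show "(\<lambda>x. \<Sum>i\<in>planes t. h (\<sigma> i t) x, \<lambda>x. \<Sum>i\<in>planes s. h (\<sigma> i s) x) \<in> omega_pow ?E - Id"
      unfolding planes \<sigma>_def
    proof (rule slice_sum_strict[where V = "{v. sorted_wrt ?I2 v}" and h = h, OF E fin st(3)])
      fix y assume "y \<in> set (drop (length s) t)"
      then have "y \<in> set u" by (simp add: u)
      moreover have "hd s \<in> set s" using s_ne by simp
      ultimately have "?I3 (hd s) y" using st(2) unfolding u antichain_seqs_append by blast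
      then obtain k where "k < 3" "coord k y < coord k (hd s)"
        using incomparable_coord_less by blast
      then show "\<exists>i\<in>planes s. coord (fst i) y = snd i"
        unfolding planes_def by (intro bexI[of _ "(k, coord k y)"]) auto
    qed (use slice[unfolded \<sigma>_def] st supp h_less in auto)
  qed
qed

text \<open>\<open>R f s\<close>: the lowest plane used by \<open>s\<close> is \<open>f 1\<close>, and there \<open>s\<close> has only elements of the
  antichain \<open>a + b = M\<close> that leave room for \<open>f 0\<close> further ones.\<close>

lemma simulated_in_antichain_seqs_nat_cube:
  "\<exists>R. simulated_in (omega_pow (natLeq_on 2)) (antichain_seqs (natLeq \<times>\<^sub>p natLeq \<times>\<^sub>p natLeq)) R"
proof -
  let ?T = "antichain_seqs (natLeq \<times>\<^sub>p natLeq \<times>\<^sub>p natLeq)"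
  \<comment> \<open>Smaller sums in the higher planes keep their entries incomparable to the
    antidiagonal of the lowest plane: they are too high to lie below it and their sums are too small
    to lie above it.\<close>
  define ok where "ok = (\<lambda>(f :: nat \<Rightarrow> nat) M (k, a, b). f 1 < k \<and> a + b < M \<or>
    k = f 1 \<and> a + b = M \<and> a + f 0 \<le> M)"
  define R where "R f s \<longleftrightarrow> s \<in> ?T \<and> (\<exists>M\<ge>f 0. \<forall>p\<in>set s. ok f M p)" for f s
  have "(p, p) \<in> natLeq \<times>\<^sub>p natLeq \<times>\<^sub>p natLeq" for p
    by (cases p) (simp add: prod_rel_def natLeq_def)
  then have F: "Field (natLeq \<times>\<^sub>p natLeq \<times>\<^sub>p natLeq) = UNIV" by (blast intro: FieldI1)
  have snoc: "s @ [p] \<in> ?T" if "s \<in> ?T"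
    "\<forall>q\<in>set s. incomparable (natLeq \<times>\<^sub>p natLeq \<times>\<^sub>p natLeq) q p" for s p
    using that unfolding antichain_seqs_append by (simp add: antichain_seqs_iff F)
  show ?thesis
  proof (rule exI[of _ R], unfold simulated_in_def, intro conjI ballI allI impI)
    fix f :: "nat \<Rightarrow> nat"
    have "[(f 1, 0, f 0)] \<in> ?T" by (simp add: antichain_seqs_iff F)
    then show "\<exists>s\<in>?T. R f s"
      by (intro bexI[of _ "[(f 1, 0, f 0)]"]) (auto simp: R_def ok_def intro!: exI[of _ "f 0"])
  next
    fix f s g assume "R f s" and gf: "(g, f) \<in> omega_pow (natLeq_on 2) - Id"
    then obtain M where s: "s \<in> ?T" and M: "f 0 \<le> M" "\<forall>p\<in>set s. ok f M p" unfolding R_def by blast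
    have *: "\<exists>t\<in>?T. strict_prefix s t \<and> R g t"
      if inc: "\<forall>q\<in>set s. incomparable (natLeq \<times>\<^sub>p natLeq \<times>\<^sub>p natLeq) q p"
        and N: "g 0 \<le> N" "\<forall>q\<in>set s. ok g N q" "ok g N p" for p N
    proof (rule bexI[of _ "s @ [p]"])
      show T: "s @ [p] \<in> ?T" by (rule snoc[OF s inc])
      show "strict_prefix s (s @ [p]) \<and> R g (s @ [p])"
        unfolding R_def using T N by (auto simp: strict_prefix_def)
    qed
    from gf have "g 1 < f 1 \<or> g 1 = f 1 \<and> g 0 < f 0" unfolding omega_pow_2_strict_iff by blast
    then show "\<exists>t\<in>?T. strict_prefix s t \<and> R g t"
    proof (elim disjE conjE)
      assume less: "g 1 < f 1"
      \<comment> \<open>All earlier sums are at most \<open>M\<close>, so the new antidiagonal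
        \<open>Suc (M + g 0)\<close> exceeds them; starting at its end \<open>a = 0\<close> leaves
        room for at least \<open>g 0\<close> further points.\<close>
      show ?thesis
      proof (rule *[of "(g 1, 0, Suc (M + g 0))" "Suc (M + g 0)"])
        show "\<forall>q\<in>set s. incomparable (natLeq \<times>\<^sub>p natLeq \<times>\<^sub>p natLeq) q (g 1, 0, Suc (M + g 0))"
          using M(2) less by (fastforce simp: ok_def incomparable_nat_triples)
        show "\<forall>q\<in>set s. ok g (Suc (M + g 0)) q"
          using M(2) less by (fastforce simp: ok_def)
      qed (auto simp: ok_def)
    next
      assume eq: "g 1 = f 1" and less: "g 0 < f 0"
      \<comment> \<open>Earlier points of this plane have \<open>a\<close> at most
        \<open>M - f 0\<close>, which is less than \<open>M - g 0\<close>, so the new point of the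
        antidiagonal is distinct from them and leaves room for exactly \<open>g 0\<close>
        more.\<close>
      show ?thesis
      proof (rule *[of "(g 1, M - g 0, g 0)" M])
        show "\<forall>q\<in>set s. incomparable (natLeq \<times>\<^sub>p natLeq \<times>\<^sub>p natLeq) q (g 1, M - g 0, g 0)"
          using M less eq by (fastforce simp: ok_def incomparable_nat_triples)
        show "\<forall>q\<in>set s. ok g M q"
          using M(2) less eq by (fastforce simp: ok_def)
      qed (use M(1) less in \<open>auto simp: ok_def\<close>)
    qed
  qed
qed

lemma width_nat_cube: "width (natLeq \<times>\<^sub>p natLeq \<times>\<^sub>p natLeq) =o omega_pow (natLeq_on 2)"
proof -
  have w: "Well_order (omega_pow (natLeq_on 2))"
    by (rule Well_order_omega_pow[OF natLeq_on_Well_order])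
  note tr = tree_rank[OF w ranked_antichain_seqs_nat_cube, folded width_def]
  obtain R where R: "simulated_in (omega_pow (natLeq_on 2)) (antichain_seqs (natLeq \<times>\<^sub>p natLeq \<times>\<^sub>p natLeq)) R"
    using simulated_in_antichain_seqs_nat_cube by blast
  show ?thesis
    using tr(3) simulated_in_ordLeq[OF w tr(1,2) R] by (simp add: ordIso_iff_ordLeq)
qed

section \<open>Combining the bounds\<close>

lemma ord_sum_list_replicate:
  assumes r: "Well_order r"
  shows "ord_sum_list (replicate m r) =o r \<cdot>\<^sub>o natLeq_on m"
proof -
  have W: "\<forall>q\<in>set (replicate m r). Well_order q" using r by simp
  show ?thesis
  proof (rule strict_mono_onto_ordIso[OF Well_order_ord_sum_list[OF W]
        Well_order_ord_prod[OF r natLeq_on_Well_order], of prod.swap])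
    show "prod.swap ` Field (ord_sum_list (replicate m r)) = Field (r \<cdot>\<^sub>o natLeq_on m)"
      unfolding Field_ord_sum_list[OF W] Field_ord_prod[OF r natLeq_on_Well_order] Field_natLeq_on
      by (auto simp: image_iff)
    show "(prod.swap p, prod.swap q) \<in> r \<cdot>\<^sub>o natLeq_on m - Id"
      if "(p, q) \<in> ord_sum_list (replicate m r) - Id" for p q
      using that by (cases p, cases q) (auto simp: ord_sum_list_def ord_prod_def Field_natLeq_on)
  qed
qed

theorem theorem4p18:
  fixes P :: "'a rel"
  assumes "well_partial_order P" and "transferable P"
  shows
    "(\<forall>m::nat. 1 \<le> m \<longrightarrow>
        width P \<cdot>\<^sub>o natLeq_on m \<le>o width (P \<times>\<^sub>p natLeq_on m) \<and>
        width (P \<times>\<^sub>p natLeq_on m) \<le>o width P \<otimes>\<^sub>o natLeq_on m) \<and>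
     (\<forall>\<gamma> :: 'b rel. Well_order \<gamma> \<longrightarrow> width P =o omega_pow \<gamma> \<longrightarrow>
        (\<forall>m::nat. 1 \<le> m \<longrightarrow> width (P \<times>\<^sub>p natLeq_on m) =o width P \<cdot>\<^sub>o natLeq_on m)) \<and>
     width (natLeq \<times>\<^sub>p natLeq \<times>\<^sub>p natLeq) =o omega_pow (natLeq_on 2)"
proof -
  have P: "Partial_order P" "no_infinite_antichains P"
    using assms(1) unfolding well_partial_order_def by auto
  have W: "Well_order (width P)" by (rule ranked_width(1)[OF P])
  \<comment> \<open>The list of exponents is left open for two uses: the normal form of
    \<open>width P\<close> yields the natural product in (1), and the single exponent
    \<open>\<gamma>\<close> yields \<open>m\<close> equal summands in (2).\<close>
  have bounds: "width P \<cdot>\<^sub>o natLeq_on m \<le>o width (P \<times>\<^sub>p natLeq_on m) \<and>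
      width (P \<times>\<^sub>p natLeq_on m) \<le>o ord_sum_list (map omega_pow (concat (map (replicate m) es)))"
    if es: "\<forall>e\<in>set es. Well_order e" "descending es"
      "width P \<le>o ord_sum_list (map omega_pow es)" for m and es :: "'c rel list"
  proof -
    obtain \<gamma> :: "('c set \<Rightarrow> nat) rel" where \<gamma>: "Well_order \<gamma>"
      "ranked_by (antichain_seqs (P \<times>\<^sub>p natLeq_on m)) \<gamma>"
      "\<gamma> =o ord_sum_list (map omega_pow (concat (map (replicate m) es)))"
      using width_prod_upper[OF P es, of m] by blast
    note tr = tree_rank[OF \<gamma>(1,2), folded width_def]
    show ?thesis
      using width_prod_lower[OF P assms(2) tr(1,2)] ordLeq_ordIso_trans[OF tr(3) \<gamma>(3)] by blast
  qed
  have "width P \<cdot>\<^sub>o natLeq_on m \<le>o width (P \<times>\<^sub>p natLeq_on m) \<and>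
      width (P \<times>\<^sub>p natLeq_on m) \<le>o width P \<otimes>\<^sub>o natLeq_on m" for m
  proof -
    note b = bounds[OF cnf(1,2)[OF W] ordIso_imp_ordLeq[OF cnf(3)[OF W]], of m]
    show ?thesis
      using b ordLeq_ordIso_trans[OF _ ordIso_symmetric[OF nat_prod_natLeq_on[OF W, of m]]] by blast
  qed
  moreover have "width (P \<times>\<^sub>p natLeq_on m) =o width P \<cdot>\<^sub>o natLeq_on m"
    if \<gamma>: "Well_order \<gamma>" "width P =o omega_pow \<gamma>" for m and \<gamma> :: "'b rel"
  proof -
    have w: "Well_order (omega_pow \<gamma>)" by (rule Well_order_omega_pow[OF \<gamma>(1)])
    have "width P =o ord_sum_list (map omega_pow [\<gamma>])"
      using ordIso_transitive[OF \<gamma>(2) ord_sum_list_singleton[OF w]] by simp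
    then have b: "width P \<cdot>\<^sub>o natLeq_on m \<le>o width (P \<times>\<^sub>p natLeq_on m)"
      "width (P \<times>\<^sub>p natLeq_on m) \<le>o ord_sum_list (replicate m (omega_pow \<gamma>))"
      using bounds[of "[\<gamma>]" m] \<gamma>(1) by (simp_all add: ordIso_imp_ordLeq map_replicate)
    note b(2)
    also have "ord_sum_list (replicate m (omega_pow \<gamma>)) =o omega_pow \<gamma> \<cdot>\<^sub>o natLeq_on m"
      by (rule ord_sum_list_replicate[OF w])
    also have "omega_pow \<gamma> \<cdot>\<^sub>o natLeq_on m \<le>o width P \<cdot>\<^sub>o natLeq_on m"
      by (rule ord_prod_mono_left[OF ordIso_imp_ordLeq[OF ordIso_symmetric[OF \<gamma>(2)]] natLeq_on_Well_order])
    finally show ?thesis using b(1) by (simp add: ordIso_iff_ordLeq)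
  qed
  ultimately show ?thesis using width_nat_cube by blast
qed

end
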